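(* Let $\Phi$ be an epimorphism of a finite thick generalized quadrangle $\mathcal{S}$ of order $(s,t)$ onto a grid $\mathcal{G}$ of order $(s',1)$. Then $s'=1$, and exactly two classes of epimorphisms $\Phi$ occur, up to a suitable permutation of the points of $\mathcal{G}$; that is, after suitably naming the points of $\mathcal{G}$, $\Phi$ is as in (a) or (b) below, and both classes occur. (a) The points of $\mathcal{G}$ are $\overline{a},\overline{b},\overline{c},\overline{d}$, with $\overline{a}\sim\overline{b}\sim\overline{c}\sim\overline{d}\sim\overline{a}$; put $\widetilde{A}=\Phi^{-1}(\overline{a})$, $\widetilde{B}=\Phi^{-1}(\overline{b})$, $\widetilde{C}=\Phi^{-1}(\overline{c})$, $\widetilde{D}=\Phi^{-1}(\overline{d})$. There is a line $L$ of $\mathcal{S}$ such that $(\widetilde{A},\widetilde{B})$, with $1\le|\widetilde{A}|\le s$ and $1\le|\widetilde{B}|\le s$, is a partition of the set of all points incident with $L$; $\widetilde{C}$ consists of the points not incident with $L$ but collinear with a point of $\widetilde{B}$; and $\widetilde{D}$ consists of the points not incident with $L$ but collinear with a point of $\widetilde{A}$. Further, $\Phi^{-1}(\overline{a}\overline{b})=\{L\}$; $\Phi^{-1}(\overline{b}\overline{c})$ is the set of all lines distinct from $L$ but incident with a point of $\widetilde{B}$; $\Phi^{-1}(\overline{a}\overline{d})$ is the set of all lines distinct from $L$ but incident with a point of $\widetilde{A}$; and $\Phi^{-1}(\overline{c}\overline{d})$ consists of all lines incident with at least one point of $\widetilde{C}$ and at least one point of $\widetilde{D}$. (b) The dual of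 (a), i.e. $\Phi$, regarded as an epimorphism from the point-line dual of $\mathcal{S}$ onto the point-line dual of $\mathcal{G}$, is as in (a).
   Context: A point-line geometry is a weak generalized $m$-gon ($m\ge 3$) if any two elements (points or lines) lie in a common ordinary sub $m$-gon and there are no ordinary sub $k$-gons for $2\le k<m$; it is thick (a generalized $m$-gon) if every point is on at least three lines and every line has at least three points. Generalized quadrangles are the case $m=4$. Order $(u,v)$ means that each line is incident with $u+1$ points and each point with $v+1$ lines. A grid of order $(s',1)$, $s'\ge 1$, is a thin (i.e. weak and not thick) generalized $4$-gon of order $(s',1)$. $x\sim y$ means that the points $x,y$ are collinear, and $\overline{x}\overline{y}$ denotes the line joining distinct collinear points. A morphism maps points to points, lines to lines, and preserves incidence. An epimorphism is a morphism that is surjective on points and surjective on lines (surjectivity on incident point-line pairs is not required). The point-line dual is obtained by interchanging points and lines. *)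

theory Defs
  imports Main
begin

record ('p, 'l) geometry =
  pts :: "'p set"
  lns :: "'l set"
  inc :: "('p \<times> 'l) set"

text \<open>Nonemptiness is needed: the empty structure would vacuously have every order.\<close>

definition point_line_geometry :: "('p, 'l) geometry \<Rightarrow> bool" where
  "point_line_geometry S \<longleftrightarrow>
     pts S \<noteq> {} \<and> lns S \<noteq> {} \<and> inc S \<subseteq> pts S \<times> lns S"

definition elements :: "('p, 'l) geometry \<Rightarrow> ('p + 'l) set" where
  "elements S = pts S <+> lns S"

definition points_on :: "('p, 'l) geometry \<Rightarrow> 'l \<Rightarrow> 'p set" where
  "points_on S M = {x \<in> pts S. (x, M) \<in> inc S}"

definition lines_through :: "('p, 'l) geometry \<Rightarrow> 'p \<Rightarrow> 'l set" where
  "lines_through S x = {M \<in> lns S. (x, M) \<in> inc S}"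

definition dual :: "('p, 'l) geometry \<Rightarrow> ('l, 'p) geometry" where
  "dual S = \<lparr>pts = lns S, lns = pts S, inc = (inc S)\<inverse>\<rparr>"

text \<open>
  An ordinary sub k-gon is given by its vertices \<open>p 0, \<dots>, p (k - 1)\<close> and its sides
  \<open>l 0, \<dots>, l (k - 1)\<close>, the side \<open>l i\<close> joining \<open>p i\<close> and \<open>p (i + 1)\<close> (indices modulo k).
  Further incidences between vertices and sides are not excluded explicitly; such an
  incidence would produce an ordinary sub j-gon with \<open>2 \<le> j < k\<close>, so in the definition of
  weak generalized polygons it makes no difference.
\<close>

definition ordinary_subpolygon ::
  "nat \<Rightarrow> ('p, 'l) geometry \<Rightarrow> (nat \<Rightarrow> 'p) \<Rightarrow> (nat \<Rightarrow> 'l) \<Rightarrow> bool" where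
  "ordinary_subpolygon k S p l \<longleftrightarrow>
     p ` {..<k} \<subseteq> pts S \<and> l ` {..<k} \<subseteq> lns S \<and>
     inj_on p {..<k} \<and> inj_on l {..<k} \<and>
     (\<forall>i<k. (p i, l i) \<in> inc S \<and> (p (Suc i mod k), l i) \<in> inc S)"

definition weak_generalized_polygon :: "nat \<Rightarrow> ('p, 'l) geometry \<Rightarrow> bool" where
  "weak_generalized_polygon m S \<longleftrightarrow>
     3 \<le> m \<and> point_line_geometry S \<and>
     (\<forall>x\<in>elements S. \<forall>y\<in>elements S.
        \<exists>p l. ordinary_subpolygon m S p l \<and>
              x \<in> p ` {..<m} <+> l ` {..<m} \<and> y \<in> p ` {..<m} <+> l ` {..<m}) \<and>
     (\<forall>k. 2 \<le> k \<and> k < m \<longrightarrow> \<not> (\<exists>p l. ordinary_subpolygon k S p l))"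

definition thick :: "('p, 'l) geometry \<Rightarrow> bool" where
  "thick S \<longleftrightarrow>
     (\<forall>x\<in>pts S. \<exists>K \<subseteq> lines_through S x. card K = 3) \<and>
     (\<forall>M\<in>lns S. \<exists>X \<subseteq> points_on S M. card X = 3)"

definition has_order :: "('p, 'l) geometry \<Rightarrow> nat \<Rightarrow> nat \<Rightarrow> bool" where
  "has_order S u v \<longleftrightarrow>
     (\<forall>M\<in>lns S. card (points_on S M) = u + 1) \<and>
     (\<forall>x\<in>pts S. card (lines_through S x) = v + 1)"

definition finite_thick_quadrangle :: "('p, 'l) geometry \<Rightarrow> nat \<Rightarrow> nat \<Rightarrow> bool" where
  "finite_thick_quadrangle S s t \<longleftrightarrow>
     finite (pts S) \<and> finite (lns S) \<and>
     weak_generalized_polygon 4 S \<and> thick S \<and> has_order S s t"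

definition grid :: "('p, 'l) geometry \<Rightarrow> nat \<Rightarrow> bool" where
  "grid G s' \<longleftrightarrow>
     1 \<le> s' \<and> weak_generalized_polygon 4 G \<and> \<not> thick G \<and> has_order G s' 1"

definition collinear :: "('p, 'l) geometry \<Rightarrow> 'p \<Rightarrow> 'p \<Rightarrow> bool" where
  "collinear S x y \<longleftrightarrow> (\<exists>M\<in>lns S. (x, M) \<in> inc S \<and> (y, M) \<in> inc S)"

text \<open>Meaningful only for distinct collinear points of a geometry without ordinary sub 2-gons.\<close>

definition joining_line :: "('p, 'l) geometry \<Rightarrow> 'p \<Rightarrow> 'p \<Rightarrow> 'l" where
  "joining_line S x y = (THE M. M \<in> lns S \<and> (x, M) \<in> inc S \<and> (y, M) \<in> inc S)"

text \<open>
  A morphism is given by its point map \<open>f\<close> and its line map \<open>g\<close>; their values outside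
  the point and line sets are irrelevant.
\<close>

definition morphism ::
  "('p, 'l) geometry \<Rightarrow> ('q, 'm) geometry \<Rightarrow> ('p \<Rightarrow> 'q) \<Rightarrow> ('l \<Rightarrow> 'm) \<Rightarrow> bool" where
  "morphism S G f g \<longleftrightarrow>
     f ` pts S \<subseteq> pts G \<and> g ` lns S \<subseteq> lns G \<and>
     (\<forall>x M. (x, M) \<in> inc S \<longrightarrow> (f x, g M) \<in> inc G)"

definition epimorphism ::
  "('p, 'l) geometry \<Rightarrow> ('q, 'm) geometry \<Rightarrow> ('p \<Rightarrow> 'q) \<Rightarrow> ('l \<Rightarrow> 'm) \<Rightarrow> bool" where
  "epimorphism S G f g \<longleftrightarrow> morphism S G f g \<and> f ` pts S = pts G \<and> g ` lns S = lns G"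

definition point_fibre :: "('p, 'l) geometry \<Rightarrow> ('p \<Rightarrow> 'q) \<Rightarrow> 'q \<Rightarrow> 'p set" where
  "point_fibre S f a = {x \<in> pts S. f x = a}"

definition line_fibre :: "('p, 'l) geometry \<Rightarrow> ('l \<Rightarrow> 'm) \<Rightarrow> 'm \<Rightarrow> 'l set" where
  "line_fibre S g N = {M \<in> lns S. g M = N}"

text \<open>
  The argument \<open>s\<close> is the first parameter of the order of \<open>S\<close>. The existential choice of
  \<open>a\<close>, \<open>b\<close>, \<open>c\<close>, \<open>d\<close> is the naming of the points of \<open>G\<close>.
\<close>

definition class_a ::
  "nat \<Rightarrow> ('p, 'l) geometry \<Rightarrow> ('q, 'm) geometry \<Rightarrow> ('p \<Rightarrow> 'q) \<Rightarrow> ('l \<Rightarrow> 'm) \<Rightarrow> bool" where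
  "class_a s S G f g \<longleftrightarrow>
     (\<exists>a b c d. distinct [a, b, c, d] \<and> pts G = {a, b, c, d} \<and>
        collinear G a b \<and> collinear G b c \<and> collinear G c d \<and> collinear G d a \<and>
        (let A = point_fibre S f a; B = point_fibre S f b;
             C = point_fibre S f c; D = point_fibre S f d
         in \<exists>L\<in>lns S.
              1 \<le> card A \<and> card A \<le> s \<and> 1 \<le> card B \<and> card B \<le> s \<and>
              A \<union> B = points_on S L \<and> A \<inter> B = {} \<and>
              C = {x \<in> pts S. (x, L) \<notin> inc S \<and> (\<exists>y\<in>B. collinear S x y)} \<and>
              D = {x \<in> pts S. (x, L) \<notin> inc S \<and> (\<exists>y\<in>A. collinear S x y)} \<and>
              line_fibre S g (joining_line G a b) = {L} \<and>
              line_fibre S g (joining_line G b c) =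
                {M \<in> lns S. M \<noteq> L \<and> (\<exists>y\<in>B. (y, M) \<in> inc S)} \<and>
              line_fibre S g (joining_line G a d) =
                {M \<in> lns S. M \<noteq> L \<and> (\<exists>y\<in>A. (y, M) \<in> inc S)} \<and>
              line_fibre S g (joining_line G c d) =
                {M \<in> lns S. (\<exists>x\<in>C. (x, M) \<in> inc S) \<and> (\<exists>y\<in>D. (y, M) \<in> inc S)}))"

text \<open>The dual of a quadrangle of order \<open>(s, t)\<close> has order \<open>(t, s)\<close>, so the bound becomes \<open>t\<close>.\<close>

definition class_b ::
  "nat \<Rightarrow> ('p, 'l) geometry \<Rightarrow> ('q, 'm) geometry \<Rightarrow> ('p \<Rightarrow> 'q) \<Rightarrow> ('l \<Rightarrow> 'm) \<Rightarrow> bool" where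
  "class_b t S G f g \<longleftrightarrow> class_a t (dual S) (dual G) g f"

end

theory Submission
  imports Defs
begin

text \<open>
  Let \<open>L\<close>, \<open>M\<close> be intersecting lines of the grid. Its lines fall into two parallel classes, the
  rows and the columns, and recording whether the image of a point lies on \<open>L\<close> and on \<open>M\<close> splits
  the points of the quadrangle into four cells. Projecting between disjoint lines and between
  noncollinear points shows that the number of points of a cell on a row or column meeting it, and
  the number of rows through a point of a cell, are constant. Projecting onto a fixed line then
  writes the size of each cell as a product of three of these constants, and the total
  \<open>(s + 1) (s t + 1)\<close> is the maximum of the resulting multiaffine function on the box
  \<open>[1, s]\<^sup>2 \<times> [1, t]\<^sup>2\<close>. The maximum is attained only on eight edges of the box, and on each of
  them some cell or some class of lines is a singleton. If \<open>s' \<ge> 2\<close>, three pairwise noncollinear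
  points force as many rows as columns through every point, and the count of all points then gives
  \<open>(s - 1) (t - 1) = 0\<close>. If \<open>s' = 1\<close>, a singleton class of lines gives (a) by projections, and a
  singleton cell gives (b) by duality.
\<close>

section \<open>Generalized quadrangles\<close>

text \<open>The obstacle is that \<open>epimorphism\<close> says nothing about incident pairs: a
  line of \<open>S\<close> could a priori contain no point over some point of its image. That the
  counts are positive therefore needs proof, and it comes from projecting a point of another cell
  onto the line. Constancy is also indirect. Two rows with the same label may meet and two points of
  one cell may be collinear, so each is compared with a row or a point of opposite labels, where
  disjointness or noncollinearity is automatic. The eight extremal edges match the eight classes.
  Each of the four cells and each of the four classes of lines has as its size a product of three of
  the constants, and every edge sets the three factors of one of these products to 1.\<close>

locale quadrangle =
  fixes S :: "('p, 'l) geometry"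
  assumes geometry: "point_line_geometry S"
    and join_unique: "\<lbrakk>(x, M) \<in> inc S; (y, M) \<in> inc S; (x, N) \<in> inc S; (y, N) \<in> inc S\<rbrakk>
      \<Longrightarrow> x = y \<or> M = N"
    and proj_ex: "\<lbrakk>x \<in> pts S; M \<in> lns S; (x, M) \<notin> inc S\<rbrakk>
      \<Longrightarrow> \<exists>N y. (x, N) \<in> inc S \<and> (y, N) \<in> inc S \<and> (y, M) \<in> inc S"
    and proj_unique: "\<lbrakk>(x, M) \<notin> inc S; (x, N) \<in> inc S; (y, N) \<in> inc S; (y, M) \<in> inc S;
        (x, N') \<in> inc S; (y', N') \<in> inc S; (y', M) \<in> inc S\<rbrakk> \<Longrightarrow> y = y' \<and> N = N'"

lemma (in quadrangle) incD:
  assumes "(x, M) \<in> inc S"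
  shows "x \<in> pts S" "M \<in> lns S"
  using assms geometry by (auto simp: point_line_geometry_def)

lemma point_line_geometry_dual:
  "point_line_geometry S \<Longrightarrow> point_line_geometry (dual S)"
  by (auto simp: point_line_geometry_def dual_def)

lemma (in quadrangle) quadrangle_dual: "quadrangle (dual S)"
proof
  show "point_line_geometry (dual S)"
    by (rule point_line_geometry_dual[OF geometry])
next
  fix K x K' y
  assume "(K, x) \<in> inc (dual S)" "(K', x) \<in> inc (dual S)"
    "(K, y) \<in> inc (dual S)" "(K', y) \<in> inc (dual S)"
  then show "K = K' \<or> x = y"
    using join_unique by (auto simp: dual_def)
next
  fix K x
  assume "K \<in> pts (dual S)" "x \<in> lns (dual S)" "(K, x) \<notin> inc (dual S)"
  then show "\<exists>y N. (K, y) \<in> inc (dual S) \<and> (N, y) \<in> inc (dual S) \<and> (N, x) \<in> inc (dual S)"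
    using proj_ex[of x K] by (auto simp: dual_def)
next
  fix K x y N y' N'
  assume "(K, x) \<notin> inc (dual S)" "(K, y) \<in> inc (dual S)" "(N, y) \<in> inc (dual S)"
    "(N, x) \<in> inc (dual S)" "(K, y') \<in> inc (dual S)" "(N', y') \<in> inc (dual S)"
    "(N', x) \<in> inc (dual S)"
  then show "N = N' \<and> y = y'"
    using proj_unique[of x K N y N' y'] by (auto simp: dual_def)
qed

section \<open>Ordinary subpolygons and the incidence axioms\<close>

lemma ordinary_subpolygon_2:
  "ordinary_subpolygon 2 S p l \<longleftrightarrow>
    {p 0, p 1} \<subseteq> pts S \<and> {l 0, l 1} \<subseteq> lns S \<and> p 0 \<noteq> p 1 \<and> l 0 \<noteq> l 1 \<and>
    {(p 0, l 0), (p 1, l 0), (p 1, l 1), (p 0, l 1)} \<subseteq> inc S"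
proof -
  have *: "{..<2} = {0, 1::nat}"
    by auto
  have all: "(\<forall>i<2. P i) \<longleftrightarrow> (\<forall>i\<in>{0, 1}. P i)" for P :: "nat \<Rightarrow> bool"
    unfolding *[symmetric] by auto
  show ?thesis
    unfolding ordinary_subpolygon_def all * by (auto simp: insert_Diff_if numeral_2_eq_2)
qed

lemma ordinary_subpolygon_3:
  "ordinary_subpolygon 3 S p l \<longleftrightarrow>
    {p 0, p 1, p 2} \<subseteq> pts S \<and> {l 0, l 1, l 2} \<subseteq> lns S \<and>
    distinct [p 0, p 1, p 2] \<and> distinct [l 0, l 1, l 2] \<and>
    {(p 0, l 0), (p 1, l 0), (p 1, l 1), (p 2, l 1), (p 2, l 2), (p 0, l 2)} \<subseteq> inc S"
proof -
  have *: "{..<3} = {0, 1, 2::nat}"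
    by auto
  have all: "(\<forall>i<3. P i) \<longleftrightarrow> (\<forall>i\<in>{0, 1, 2}. P i)" for P :: "nat \<Rightarrow> bool"
    unfolding *[symmetric] by auto
  show ?thesis
    unfolding ordinary_subpolygon_def all * by (auto simp: insert_Diff_if numeral_2_eq_2)
qed

lemma ordinary_subpolygon_4:
  "ordinary_subpolygon 4 S p l \<longleftrightarrow>
    {p 0, p 1, p 2, p 3} \<subseteq> pts S \<and> {l 0, l 1, l 2, l 3} \<subseteq> lns S \<and>
    distinct [p 0, p 1, p 2, p 3] \<and> distinct [l 0, l 1, l 2, l 3] \<and>
    {(p 0, l 0), (p 1, l 0), (p 1, l 1), (p 2, l 1), (p 2, l 2), (p 3, l 2), (p 3, l 3), (p 0, l 3)}
      \<subseteq> inc S"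
proof -
  have *: "{..<4} = {0, 1, 2, 3::nat}"
    by auto
  have all: "(\<forall>i<4. P i) \<longleftrightarrow> (\<forall>i\<in>{0, 1, 2, 3}. P i)" for P :: "nat \<Rightarrow> bool"
    unfolding *[symmetric] by auto
  have mods: "Suc 0 mod 4 = 1" "Suc 1 mod 4 = 2" "Suc 2 mod 4 = 3" "Suc 3 mod 4 = 0"
    by simp_all
  show ?thesis
    unfolding ordinary_subpolygon_def all * ball_simps mods by (auto simp: insert_Diff_if)
qed

text \<open>A digon or a triangle would arise from two joining lines or two projections, and a
  common ordinary quadrangle contains a projection. The axioms of \<open>quadrangle\<close> mention
  neither thickness nor an order, so this applies to the grid as well as to
  \<open>S\<close>.\<close>

lemma quadrangle_if_weak_generalized_polygon:
  assumes "weak_generalized_polygon 4 S"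
  shows "quadrangle S"
proof
  show geom: "point_line_geometry S"
    using assms by (simp add: weak_generalized_polygon_def)
  have incD: "x \<in> pts S" "M \<in> lns S" if "(x, M) \<in> inc S" for x M
    using that geom by (auto simp: point_line_geometry_def)
  have no2: "\<not> ordinary_subpolygon 2 S p l" and no3: "\<not> ordinary_subpolygon 3 S p l" for p l
    using assms by (auto simp: weak_generalized_polygon_def)
  show uniq: "x = y \<or> M = N"
    if "(x, M) \<in> inc S" "(y, M) \<in> inc S" "(x, N) \<in> inc S" "(y, N) \<in> inc S" for x M y N
  proof (rule ccontr)
    assume "\<not> (x = y \<or> M = N)"
    then have "ordinary_subpolygon 2 S (\<lambda>i. if i = 0 then x else y) (\<lambda>i. if i = 0 then M else N)"
      using that incD
      by (simp_all add: ordinary_subpolygon_2)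
    with no2 show False
      by blast
  qed
  show "\<exists>N y. (x, N) \<in> inc S \<and> (y, N) \<in> inc S \<and> (y, M) \<in> inc S"
    if x: "x \<in> pts S" and M: "M \<in> lns S" and xM: "(x, M) \<notin> inc S" for x M
  proof -
    have "Inl x \<in> elements S" "Inr M \<in> elements S"
      using x M by (auto simp: elements_def)
    then obtain p l where pl: "ordinary_subpolygon 4 S p l"
      and "Inl x \<in> p ` {..<4} <+> l ` {..<4}" "Inr M \<in> p ` {..<4} <+> l ` {..<4}"
      using assms unfolding weak_generalized_polygon_def by metis
    then obtain i j where ij: "i < 4" "j < 4" "x = p i" "M = l j"
      by auto
    have lt4: "(n::nat) < 4 \<longleftrightarrow> n = 0 \<or> n = 1 \<or> n = 2 \<or> n = 3" for n
      by auto
    have "(p 0, l 0) \<in> inc S" "(p 1, l 0) \<in> inc S" "(p 1, l 1) \<in> inc S" "(p 2, l 1) \<in> inc S"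
      "(p 2, l 2) \<in> inc S" "(p 3, l 2) \<in> inc S" "(p 3, l 3) \<in> inc S" "(p 0, l 3) \<in> inc S"
      using pl by (auto simp: ordinary_subpolygon_4)
    \<comment> \<open>In a 4-cycle a vertex off a side is joined by another side to one end of it;
      the sixteen pairs \<open>i\<close>, \<open>j\<close> are checked one by one.\<close>
    then show ?thesis
      using ij xM unfolding lt4 by (elim disjE; simp; blast)
  qed
  show "y = y' \<and> N = N'"
    if xM: "(x, M) \<notin> inc S" and xN: "(x, N) \<in> inc S" and yN: "(y, N) \<in> inc S"
      and yM: "(y, M) \<in> inc S" and xN': "(x, N') \<in> inc S" and yN': "(y', N') \<in> inc S"
      and yM': "(y', M) \<in> inc S" for x M N y N' y'
  proof -
    have "y = y'"
    proof (rule ccontr)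
      assume ne: "y \<noteq> y'"
      have "N \<noteq> N'"
        using ne uniq[OF yM yM'] yN yN' xN xM by metis
      moreover have "N \<noteq> M" "N' \<noteq> M" "x \<noteq> y" "x \<noteq> y'"
        using xM xN xN' yM yM' by auto
      ultimately have "ordinary_subpolygon 3 S (\<lambda>i. if i = 0 then x else if i = 1 then y else y')
          (\<lambda>i. if i = 0 then N else if i = 1 then M else N')"
        using that ne incD
        by (simp_all add: ordinary_subpolygon_3)
      with no3 show False
        by blast
    qed
    then show ?thesis
      using uniq[OF xN yN xN'] yN' xM yM by auto
  qed
qed

section \<open>From the incidence axioms back to ordinary quadrangles\<close>

lemma (in quadrangle) no_digon: "\<not> ordinary_subpolygon 2 S p l"
proof
  assume "ordinary_subpolygon 2 S p l"
  then have "(p 0, l 0) \<in> inc S" "(p 1, l 0) \<in> inc S" "(p 1, l 1) \<in> inc S" "(p 0, l 1) \<in> inc S"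
    "p 0 \<noteq> p 1" "l 0 \<noteq> l 1"
    by (simp_all add: ordinary_subpolygon_2)
  then show False
    using join_unique[of "p 0" "l 0" "p 1" "l 1"] by simp
qed

lemma (in quadrangle) no_triangle: "\<not> ordinary_subpolygon 3 S p l"
proof
  assume "ordinary_subpolygon 3 S p l"
  then have *: "(p 0, l 0) \<in> inc S" "(p 1, l 0) \<in> inc S" "(p 1, l 1) \<in> inc S"
    "(p 2, l 1) \<in> inc S" "(p 2, l 2) \<in> inc S" "(p 0, l 2) \<in> inc S"
    "p 1 \<noteq> p 2" "p 0 \<noteq> p 1" "l 0 \<noteq> l 1"
    by (simp_all add: ordinary_subpolygon_3)
  then have "(p 0, l 1) \<notin> inc S"
    using join_unique[of "p 0" "l 0" "p 1" "l 1"] by auto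
  then show False
    using * proj_unique[of "p 0" "l 1" "l 0" "p 1" "l 2" "p 2"] by simp
qed

text \<open>The path \<open>K\<close>, \<open>x\<close>, \<open>N\<close>, \<open>y\<close>,
  \<open>M\<close>, \<open>z\<close> is closed by projecting \<open>z\<close> onto \<open>K\<close>.
  Degeneration of the resulting 4-cycle would give \<open>x\<close> a second projection onto
  \<open>M\<close>, or two points a second joining line.\<close>

lemma (in quadrangle) ordinary_quadrangle_through_path:
  assumes xM: "(x, M) \<notin> inc S" and xN: "(x, N) \<in> inc S" and yN: "(y, N) \<in> inc S"
    and yM: "(y, M) \<in> inc S" and zM: "(z, M) \<in> inc S" and zy: "z \<noteq> y"
    and xK: "(x, K) \<in> inc S" and KN: "K \<noteq> N"
  shows "\<exists>p l. ordinary_subpolygon 4 S p l \<and> {x, y, z} \<subseteq> p ` {..<4} \<and> {N, M, K} \<subseteq> l ` {..<4}"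
proof -
  have zK: "(z, K) \<notin> inc S"
    using proj_unique[OF xM xN yN yM xK _ zM] zy by blast
  obtain J w where J: "(z, J) \<in> inc S" "(w, J) \<in> inc S" "(w, K) \<in> inc S"
    using proj_ex[OF _ _ zK] incD zM xK by blast
  have zN: "(z, N) \<notin> inc S"
    using join_unique[OF zM yM _ yN] zy xM xN by blast
  have wM: "(w, M) \<notin> inc S"
    using proj_unique[OF xM xN yN yM xK J(3)] KN by blast
  have "x \<noteq> y" "x \<noteq> z" "N \<noteq> M" "K \<noteq> M" "J \<noteq> K" "w \<noteq> z" "J \<noteq> N" "J \<noteq> M" "w \<noteq> y"
    using xM yM zM xN xK J zK zN wM by auto
  moreover have "w \<noteq> x"
    using proj_unique[OF xM xN yN yM _ J(1) zM] J(2) zy by blast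
  ultimately have "ordinary_subpolygon 4 S
      (\<lambda>i. if i = 0 then x else if i = 1 then y else if i = 2 then z else w)
      (\<lambda>i. if i = 0 then N else if i = 1 then M else if i = 2 then J else K)"
    (is "ordinary_subpolygon 4 S ?p ?l")
    using assms J incD
    by (auto simp: ordinary_subpolygon_4)
  moreover have "{x, y, z} \<subseteq> ?p ` {..<4}" "{N, M, K} \<subseteq> ?l ` {..<4}"
    by (auto intro!: image_eqI[where x = 0] image_eqI[where x = 1] image_eqI[where x = 2]
        image_eqI[where x = 3])
  ultimately show ?thesis
    by blast
qed

text \<open>This converse of \<open>quadrangle_if_weak_generalized_polygon\<close> certifies the
  examples. Any two elements lie on a path as in \<open>ordinary_quadrangle_through_path\<close>,
  lengthened where necessary by the second points and lines that the hypotheses supply.\<close>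

lemma (in quadrangle) weak_generalized_polygonI:
  assumes two_points: "\<And>x M. (x, M) \<in> inc S \<Longrightarrow> \<exists>y. y \<noteq> x \<and> (y, M) \<in> inc S"
    and two_lines: "\<And>x M. (x, M) \<in> inc S \<Longrightarrow> \<exists>N. N \<noteq> M \<and> (x, N) \<in> inc S"
    and line_ex: "\<And>x. x \<in> pts S \<Longrightarrow> \<exists>M. (x, M) \<in> inc S"
    and point_ex: "\<And>M. M \<in> lns S \<Longrightarrow> \<exists>x. (x, M) \<in> inc S"
  shows "weak_generalized_polygon 4 S"
proof -
  define Q where "Q X K \<longleftrightarrow> (\<exists>p l. ordinary_subpolygon 4 S p l \<and> X \<subseteq> p ` {..<4} \<and> K \<subseteq> l ` {..<4})"
    for X K
  have Q_mono: "Q X' K'" if "Q X K" "X' \<subseteq> X" "K' \<subseteq> K" for X K X' K'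
    using that unfolding Q_def by blast
  have path: "Q {x, y, z} {N, M, K}"
    if "(x, M) \<notin> inc S" "(x, N) \<in> inc S" "(y, N) \<in> inc S" "(y, M) \<in> inc S" "(z, M) \<in> inc S" "z \<noteq> y"
      "(x, K) \<in> inc S" "K \<noteq> N" for x y z M N K
    using ordinary_quadrangle_through_path[OF that] unfolding Q_def .
  have corner: "Q {y, z} {N, M}"
    if "(y, N) \<in> inc S" "(y, M) \<in> inc S" "N \<noteq> M" "(z, M) \<in> inc S" "z \<noteq> y" for y z M N
  proof -
    obtain x where x: "x \<noteq> y" "(x, N) \<in> inc S"
      using two_points \<open>(y, N) \<in> inc S\<close> by blast
    obtain K where K: "K \<noteq> N" "(x, K) \<in> inc S"
      using two_lines x(2) by blast
    have "(x, M) \<notin> inc S"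
      using join_unique[OF x(2) \<open>(y, N) \<in> inc S\<close>] that x(1) by blast
    then have "Q {x, y, z} {N, M, K}"
      using path that x K by blast
    then show ?thesis
      by (rule Q_mono) auto
  qed
  have edge: "Q {x, y} {M}" if xM: "(x, M) \<in> inc S" and yM: "(y, M) \<in> inc S" and "x \<noteq> y" for x y M
  proof -
    obtain N where "N \<noteq> M" "(x, N) \<in> inc S"
      using two_lines xM by blast
    then have "Q {x, y} {N, M}"
      using corner[of x N M y] xM yM \<open>x \<noteq> y\<close> by blast
    then show ?thesis
      by (rule Q_mono) auto
  qed
  have flag: "Q {x} {M}" if xM: "(x, M) \<in> inc S" for x M
  proof -
    obtain y where "y \<noteq> x" "(y, M) \<in> inc S"
      using two_points xM by blast
    then have "Q {x, y} {M}"
      using edge xM by blast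
    then show ?thesis
      by (rule Q_mono) auto
  qed
  have pl: "Q {x} {M}" if x: "x \<in> pts S" and M: "M \<in> lns S" for x M
  proof (cases "(x, M) \<in> inc S")
    case False
    then obtain N y where N: "(x, N) \<in> inc S" "(y, N) \<in> inc S" "(y, M) \<in> inc S"
      using proj_ex x M by blast
    obtain z where z: "z \<noteq> y" "(z, M) \<in> inc S"
      using two_points N(3) by blast
    obtain K where K: "K \<noteq> N" "(x, K) \<in> inc S"
      using two_lines N(1) by blast
    have "Q {x, y, z} {N, M, K}"
      using path False N z K by blast
    then show ?thesis
      by (rule Q_mono) auto
  qed (rule flag)
  have pp: "Q {x, y} {}" if x: "x \<in> pts S" and y: "y \<in> pts S" for x y
  proof (cases "\<exists>M. (x, M) \<in> inc S \<and> (y, M) \<in> inc S")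
    case True
    then obtain M where M: "(x, M) \<in> inc S" "(y, M) \<in> inc S"
      by blast
    show ?thesis
    proof (cases "x = y")
      case True
      show ?thesis
        using flag[OF M(1)] by (rule Q_mono) (auto simp: True)
    next
      case False
      show ?thesis
        using edge[OF M False] by (rule Q_mono) auto
    qed
  next
    case False
    obtain M where M: "(y, M) \<in> inc S"
      using line_ex y by blast
    have xM: "(x, M) \<notin> inc S"
      using False M by blast
    then obtain N z where N: "(x, N) \<in> inc S" "(z, N) \<in> inc S" "(z, M) \<in> inc S"
      using proj_ex x incD(2)[OF M] by blast
    obtain K where K: "K \<noteq> N" "(x, K) \<in> inc S"
      using two_lines N(1) by blast
    have "y \<noteq> z"
      using False N by blast
    then have "Q {x, z, y} {N, M, K}"
      using path xM N M K by blast
    then show ?thesis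
      by (rule Q_mono) auto
  qed
  have ll: "Q {} {M, N}" if M: "M \<in> lns S" and N: "N \<in> lns S" for M N
  proof (cases "\<exists>x. (x, M) \<in> inc S \<and> (x, N) \<in> inc S")
    case True
    then obtain x where x: "(x, M) \<in> inc S" "(x, N) \<in> inc S"
      by blast
    show ?thesis
    proof (cases "M = N")
      case True
      show ?thesis
        using flag[OF x(1)] by (rule Q_mono) (auto simp: True)
    next
      case False
      obtain z where "z \<noteq> x" "(z, N) \<in> inc S"
        using two_points x(2) by blast
      then have "Q {x, z} {M, N}"
        using corner x False by blast
      then show ?thesis
        by (rule Q_mono) auto
    qed
  next
    case False
    obtain x where x: "(x, N) \<in> inc S"
      using point_ex N by blast
    have xM: "(x, M) \<notin> inc S"
      using False x by blast
    then obtain K y where K: "(x, K) \<in> inc S" "(y, K) \<in> inc S" "(y, M) \<in> inc S"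
      using proj_ex M incD(1)[OF x] by blast
    obtain z where z: "z \<noteq> y" "(z, M) \<in> inc S"
      using two_points K(3) by blast
    have "N \<noteq> K"
      using False K by blast
    then have "Q {x, y, z} {K, M, N}"
      using path xM K z x by blast
    then show ?thesis
      by (rule Q_mono) auto
  qed
  have "\<exists>p l. ordinary_subpolygon 4 S p l \<and>
      e \<in> p ` {..<4} <+> l ` {..<4} \<and> e' \<in> p ` {..<4} <+> l ` {..<4}"
    if "e \<in> elements S" "e' \<in> elements S" for e e'
  proof -
    have Q_D: "\<exists>p l. ordinary_subpolygon 4 S p l \<and>
        e \<in> p ` {..<4} <+> l ` {..<4} \<and> e' \<in> p ` {..<4} <+> l ` {..<4}"
      if "Q X K" "e \<in> X <+> K" "e' \<in> X <+> K" for X K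
    proof -
      obtain p l where pl: "ordinary_subpolygon 4 S p l" and "X \<subseteq> p ` {..<4}" "K \<subseteq> l ` {..<4}"
        using \<open>Q X K\<close> unfolding Q_def by blast
      then have "X <+> K \<subseteq> p ` {..<4} <+> l ` {..<4}"
        by auto
      then show ?thesis
        using pl that(2,3) by blast
    qed
    consider x y where "e = Inl x" "e' = Inl y" "x \<in> pts S" "y \<in> pts S"
      | x M where "e = Inl x" "e' = Inr M" "x \<in> pts S" "M \<in> lns S"
      | x M where "e' = Inl x" "e = Inr M" "x \<in> pts S" "M \<in> lns S"
      | M N where "e = Inr M" "e' = Inr N" "M \<in> lns S" "N \<in> lns S"
      using \<open>e \<in> elements S\<close> \<open>e' \<in> elements S\<close> by (auto simp: elements_def)
    then show ?thesis
    proof cases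
      case 1
      then show ?thesis using Q_D[OF pp[of x y]] by (simp add: InlI InrI)
    next
      case 2
      then show ?thesis using Q_D[OF pl[of x M]] by (simp add: InlI InrI)
    next
      case 3
      then show ?thesis using Q_D[OF pl[of x M]] by (simp add: InlI InrI)
    next
      case 4
      then show ?thesis using Q_D[OF ll[of M N]] by (simp add: InlI InrI)
    qed
  qed
  moreover have "\<not> ordinary_subpolygon k S p l" if "2 \<le> k" "k < 4" for k p l
  proof -
    have "k = 2 \<or> k = 3"
      using that by auto
    then show ?thesis
      using no_digon no_triangle by blast
  qed
  ultimately show ?thesis
    using geometry unfolding weak_generalized_polygon_def by simp
qed

section \<open>Counting\<close>

text \<open>
  With every variable diminished by 1, the left-hand side of \<open>deficit\<close> is the difference of the two
  sides of the equation \<open>total\<close> in \<open>four_box_extremal\<close>. Its quadratic part is nonnegative because it has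
  three forms (\<open>X1\<close>, \<open>X2\<close>, \<open>X3\<close> below), at least one of which is a sum of nonnegative terms.
\<close>

lemma deficit_zero_cases:
  fixes a b e e' r c r' c' :: int
  assumes nonneg: "0 \<le> a" "0 \<le> b" "0 \<le> e" "0 \<le> e'" "0 \<le> r" "0 \<le> c" "0 \<le> r'" "0 \<le> c'"
    and ab: "a + b = \<sigma>" and ee: "e + e' = \<sigma>" and rc: "r + c = \<tau>" and rc': "r' + c' = \<tau>"
    and pos: "0 < \<sigma>" "0 < \<tau>"
    and deficit: "2 * (a * r + b * r' + e * c - e * r')
      + (a * e * c' + b * e * c + b * e' * r' + a * e' * r) = 0"
  shows "(a = 0 \<and> e = 0 \<and> r' = 0) \<or> (b = 0 \<and> e = 0 \<and> r = 0) \<or>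
    (b = 0 \<and> e' = 0 \<and> c' = 0) \<or> (a = 0 \<and> e' = 0 \<and> c = 0) \<or>
    (e = 0 \<and> r = 0 \<and> r' = 0) \<or> (e' = 0 \<and> c = 0 \<and> c' = 0) \<or>
    (a = 0 \<and> c = 0 \<and> r' = 0) \<or> (b = 0 \<and> r = 0 \<and> c' = 0)"
proof -
  define X where "X = a * r + b * r' + e * c - e * r'"
  have cubic: "0 \<le> a * e * c'" "0 \<le> b * e * c" "0 \<le> b * e' * r'" "0 \<le> a * e' * r"
    using nonneg by simp_all
  have def0: "2 * X + (a * e * c' + b * e * c + b * e' * r' + a * e' * r) = 0"
    using deficit by (simp add: X_def)
  have X1: "X = a * r + e * c + (b - e) * r'"
    by (simp add: X_def algebra_simps)
  have X2: "X = a * r + b * r' + e * (c - r')"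
    by (simp add: X_def algebra_simps)
  \<comment> \<open>This is the shape of \<open>X2\<close> with \<open>e\<close>, \<open>r\<close>,
    \<open>r'\<close> exchanged for \<open>e'\<close>, \<open>c'\<close>, \<open>c\<close>, which is
    the effect of negating \<open>rb\<close> on the parameters in the application.\<close>
  have X3: "X = a * c' + b * c + e' * (r' - c)"
  proof -
    have eqs: "b = \<sigma> - a" "e' = \<sigma> - e" "r = \<tau> - c" "c' = \<tau> - r'"
      using ab ee rc rc' by linarith+
    show ?thesis
      unfolding X_def eqs by (simp add: algebra_simps)
  qed
  have "0 \<le> X"
  proof -
    consider "e \<le> b" | "r' \<le> c" | "c \<le> r'"
      by linarith
    then show ?thesis
      by cases (use nonneg in \<open>simp add: X1\<close>, use nonneg in \<open>simp add: X2\<close>, use nonneg in \<open>simp add: X3\<close>)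
  qed
  with def0 cubic have X0: "X = 0" and z: "a * e * c' = 0" "b * e * c = 0" "b * e' * r' = 0" "a * e' * r = 0"
    by linarith+
  have z0: "a = 0 \<or> e = 0 \<or> c' = 0" "b = 0 \<or> e = 0 \<or> c = 0"
    "b = 0 \<or> e' = 0 \<or> r' = 0" "a = 0 \<or> e' = 0 \<or> r = 0"
    using z by auto
  consider "e \<le> b" | "e > b" "r' \<le> c" | "e > b" "c < r'"
    by linarith
  then show ?thesis
  proof cases
    case 1
    then have "0 \<le> (b - e) * r'" "0 \<le> a * r" "0 \<le> e * c"
      using nonneg by simp_all
    then have "(b - e) * r' = 0" "a * r = 0" "e * c = 0"
      using X0 X1 by linarith+
    then have "b = e \<or> r' = 0" "a = 0 \<or> r = 0" "e = 0 \<or> c = 0"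
      by auto
    then show ?thesis
      using z0 ab ee rc rc' pos by smt
  next
    case 2
    then have "0 \<le> e * (c - r')" "0 \<le> a * r" "0 \<le> b * r'"
      using nonneg by simp_all
    then have "e * (c - r') = 0" "a * r = 0" "b * r' = 0"
      using X0 X2 by linarith+
    then have "e = 0 \<or> c = r'" "a = 0 \<or> r = 0" "b = 0 \<or> r' = 0"
      by auto
    then show ?thesis
      using z0 ab ee rc rc' pos 2 nonneg by smt
  next
    case 3
    then have "0 \<le> e' * (r' - c)" "0 \<le> a * c'" "0 \<le> b * c"
      using nonneg by simp_all
    then have "e' * (r' - c) = 0" "a * c' = 0" "b * c = 0"
      using X0 X3 by linarith+
    then have "e' = 0" "a = 0 \<or> c' = 0" "b = 0 \<or> c = 0"
      using 3 by auto
    then show ?thesis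
      using z0 ab ee rc rc' pos 3 nonneg by smt
  qed
qed

text \<open>In the application \<open>\<alpha>\<close>, \<open>\<beta>\<close> are the values of
  \<open>row_points\<close>, \<open>\<eta>\<close>, \<open>\<eta>'\<close> those of
  \<open>col_points\<close>, and the others those of \<open>row_degree\<close>. The four summands of
  \<open>total\<close> are then the cell sizes. Each of the first four alternatives makes a cell a
  singleton; the last four do the same for the products in \<open>card_row_class\<close> and
  \<open>card_col_class\<close>.\<close>

lemma four_box_extremal:
  fixes \<alpha> \<beta> \<eta> \<eta>' \<rho> \<gamma> \<rho>' \<gamma>' s t :: nat
  assumes pos: "1 \<le> \<alpha>" "1 \<le> \<beta>" "1 \<le> \<eta>" "1 \<le> \<eta>'" "1 \<le> \<rho>" "1 \<le> \<gamma>" "1 \<le> \<rho>'" "1 \<le> \<gamma>'"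
    and sums: "\<alpha> + \<beta> = s + 1" "\<eta> + \<eta>' = s + 1" "\<rho> + \<gamma> = t + 1" "\<rho>' + \<gamma>' = t + 1"
    and st: "2 \<le> s" "2 \<le> t"
    and total: "\<alpha> * \<rho>' * \<eta> + \<beta> * \<rho> * \<eta> + \<beta> * \<gamma>' * \<eta>' + \<alpha> * \<gamma> * \<eta>' = (s + 1) * (s * t + 1)"
  shows "(\<alpha> = 1 \<and> \<eta> = 1 \<and> \<rho>' = 1) \<or> (\<beta> = 1 \<and> \<eta> = 1 \<and> \<rho> = 1) \<or>
    (\<beta> = 1 \<and> \<eta>' = 1 \<and> \<gamma>' = 1) \<or> (\<alpha> = 1 \<and> \<eta>' = 1 \<and> \<gamma> = 1) \<or>
    (\<eta> = 1 \<and> \<rho> = 1 \<and> \<rho>' = 1) \<or> (\<eta>' = 1 \<and> \<gamma> = 1 \<and> \<gamma>' = 1) \<or>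
    (\<alpha> = 1 \<and> \<gamma> = 1 \<and> \<rho>' = 1) \<or> (\<beta> = 1 \<and> \<rho> = 1 \<and> \<gamma>' = 1)"
proof -
  define a b e e' r c r' c' where defs: "a = int \<alpha> - 1" "b = int \<beta> - 1" "e = int \<eta> - 1" "e' = int \<eta>' - 1"
    "r = int \<rho> - 1" "c = int \<gamma> - 1" "r' = int \<rho>' - 1" "c' = int \<gamma>' - 1"
  have total': "int \<alpha> * int \<rho>' * int \<eta> + int \<beta> * int \<rho> * int \<eta> + int \<beta> * int \<gamma>' * int \<eta>'
      + int \<alpha> * int \<gamma> * int \<eta>' = (int s + 1) * (int s * int t + 1)"
    using arg_cong[OF total, of int] by (simp add: algebra_simps)
  have sums': "int \<beta> = int s + 1 - int \<alpha>" "int \<eta>' = int s + 1 - int \<eta>" "int \<gamma> = int t + 1 - int \<rho>"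
    "int \<gamma>' = int t + 1 - int \<rho>'"
    using sums by linarith+
  have "2 * (a * r + b * r' + e * c - e * r') + (a * e * c' + b * e * c + b * e' * r' + a * e' * r)
      = (int s + 1) * (int s * int t + 1) - (int \<alpha> * int \<rho>' * int \<eta> + int \<beta> * int \<rho> * int \<eta>
      + int \<beta> * int \<gamma>' * int \<eta>' + int \<alpha> * int \<gamma> * int \<eta>')"
    unfolding defs sums' by (simp add: algebra_simps)
  then have "2 * (a * r + b * r' + e * c - e * r')
      + (a * e * c' + b * e * c + b * e' * r' + a * e' * r) = 0"
    using total' by simp
  then have "(a = 0 \<and> e = 0 \<and> r' = 0) \<or> (b = 0 \<and> e = 0 \<and> r = 0) \<or>
    (b = 0 \<and> e' = 0 \<and> c' = 0) \<or> (a = 0 \<and> e' = 0 \<and> c = 0) \<or>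
    (e = 0 \<and> r = 0 \<and> r' = 0) \<or> (e' = 0 \<and> c = 0 \<and> c' = 0) \<or>
    (a = 0 \<and> c = 0 \<and> r' = 0) \<or> (b = 0 \<and> r = 0 \<and> c' = 0)"
    by (rule deficit_zero_cases[rotated -1, where \<sigma> = "int s - 1" and \<tau> = "int t - 1"])
      (use pos sums st in \<open>simp_all add: defs\<close>)
  then show ?thesis
    unfolding defs by simp
qed

text \<open>Every point of either line has a unique projection onto the other, so the transversals
  define a bijection between the two point rows. Hypothesis \<open>PQ\<close> says that it carries
  \<open>P\<close> to \<open>Q\<close>.\<close>

lemma (in quadrangle) card_points_disjoint_lines:
  assumes M: "M \<in> lns S" and N: "N \<in> lns S"
    and disj: "\<And>x. (x, M) \<in> inc S \<Longrightarrow> (x, N) \<notin> inc S"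
    and PQ: "\<And>x y K. \<lbrakk>(x, M) \<in> inc S; (y, N) \<in> inc S; (x, K) \<in> inc S; (y, K) \<in> inc S\<rbrakk>
      \<Longrightarrow> P x \<longleftrightarrow> Q y"
  shows "card {x. (x, M) \<in> inc S \<and> P x} = card {y. (y, N) \<in> inc S \<and> Q y}"
proof -
  define R where "R x y \<longleftrightarrow> (\<exists>K. (x, K) \<in> inc S \<and> (y, K) \<in> inc S)" for x y
  have ex1: "\<exists>!y. (y, N) \<in> inc S \<and> R x y" if "(x, M) \<in> inc S" for x
    using proj_ex[OF incD(1)[OF that] N disj[OF that]] proj_unique[OF disj[OF that]]
    unfolding R_def by blast
  have ex2: "\<exists>!x. (x, M) \<in> inc S \<and> R x y" if "(y, N) \<in> inc S" for y
  proof -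
    have *: "(y, M) \<notin> inc S"
      using disj that by blast
    show ?thesis
      using proj_ex[OF incD(1)[OF that] M *] proj_unique[OF *] unfolding R_def by blast
  qed
  define f where "f x = (THE y. (y, N) \<in> inc S \<and> R x y)" for x
  define g where "g y = (THE x. (x, M) \<in> inc S \<and> R x y)" for y
  have f: "(f x, N) \<in> inc S" "R x (f x)" if "(x, M) \<in> inc S" for x
    using theI'[OF ex1[OF that]] unfolding f_def by auto
  have g: "(g y, M) \<in> inc S" "R (g y) y" if "(y, N) \<in> inc S" for y
    using theI'[OF ex2[OF that]] unfolding g_def by auto
  have gf: "g (f x) = x" if "(x, M) \<in> inc S" for x
    using ex2[OF f(1)[OF that]] f[OF that] g[OF f(1)[OF that]] that by blast
  have fg: "f (g y) = y" if "(y, N) \<in> inc S" for y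
    using ex1[OF g(1)[OF that]] g[OF that] f[OF g(1)[OF that]] that by blast
  have RPQ: "P x \<longleftrightarrow> Q y" if "(x, M) \<in> inc S" "(y, N) \<in> inc S" "R x y" for x y
    using PQ that unfolding R_def by blast
  have fPQ: "Q (f x) \<longleftrightarrow> P x" if "(x, M) \<in> inc S" for x
    using RPQ f that by blast
  have gPQ: "P (g y) \<longleftrightarrow> Q y" if "(y, N) \<in> inc S" for y
    using RPQ g that by blast
  have "bij_betw f {x. (x, M) \<in> inc S \<and> P x} {y. (y, N) \<in> inc S \<and> Q y}"
    by (rule bij_betw_byWitness[where f' = g]) (use f g gf fg fPQ gPQ in auto)
  then show ?thesis
    by (rule bij_betw_same_card)
qed

lemma (in quadrangle) card_lines_noncollinear_points:
  assumes x: "x \<in> pts S" and y: "y \<in> pts S"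
    and nc: "\<And>M. (x, M) \<in> inc S \<Longrightarrow> (y, M) \<notin> inc S"
    and PQ: "\<And>M N z. \<lbrakk>(x, M) \<in> inc S; (y, N) \<in> inc S; (z, M) \<in> inc S; (z, N) \<in> inc S\<rbrakk>
      \<Longrightarrow> P M \<longleftrightarrow> Q N"
  shows "card {M. (x, M) \<in> inc S \<and> P M} = card {N. (y, N) \<in> inc S \<and> Q N}"
  using quadrangle.card_points_disjoint_lines[OF quadrangle_dual, of x y P Q] assms
  by (simp add: dual_def)

section \<open>Finite quadrangles of order (s, t)\<close>

locale finite_quadrangle = quadrangle S for S :: "('p, 'l) geometry" +
  fixes s t :: nat
  assumes finite_pts: "finite (pts S)" and finite_lns: "finite (lns S)"
    and order: "has_order S s t"
    and s_ge_2: "2 \<le> s" and t_ge_2: "2 \<le> t"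
begin

lemma mem_points_on: "x \<in> points_on S M \<longleftrightarrow> (x, M) \<in> inc S"
  using incD by (auto simp: points_on_def)

lemma mem_lines_through: "M \<in> lines_through S x \<longleftrightarrow> (x, M) \<in> inc S"
  using incD by (auto simp: lines_through_def)

lemma finite_points_on: "finite (points_on S M)"
  using finite_pts by (simp add: points_on_def)

lemma finite_lines_through: "finite (lines_through S x)"
  using finite_lns by (simp add: lines_through_def)

lemma card_points_on: "M \<in> lns S \<Longrightarrow> card (points_on S M) = s + 1"
  using order by (simp add: has_order_def)

lemma card_lines_through: "x \<in> pts S \<Longrightarrow> card (lines_through S x) = t + 1"
  using order by (simp add: has_order_def)

text \<open>A point \<open>x\<close> off \<open>M\<close> ends exactly one chain \<open>y\<close>,
  \<open>N\<close>, \<open>x\<close> that starts on \<open>M\<close> and has \<open>N\<close>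
  different from \<open>M\<close>: the one through its projection \<open>y\<close>.\<close>

lemma card_off_line:
  assumes M: "M \<in> lns S" and Q: "Q \<subseteq> pts S" and off: "\<And>x. x \<in> Q \<Longrightarrow> (x, M) \<notin> inc S"
  shows "card Q = (\<Sum>y\<in>points_on S M. \<Sum>N\<in>lines_through S y - {M}. card (points_on S N \<inter> Q))"
proof -
  let ?T = "SIGMA y:points_on S M. SIGMA N:lines_through S y - {M}. points_on S N \<inter> Q"
  have "bij_betw (snd \<circ> snd) ?T Q"
  proof (rule bij_betwI')
    fix p q
    assume "p \<in> ?T" "q \<in> ?T"
    moreover obtain y N x y' N' x' where "p = (y, N, x)" "q = (y', N', x')"
      by (metis prod_cases3)
    ultimately show "(snd \<circ> snd) p = (snd \<circ> snd) q \<longleftrightarrow> p = q"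
      using proj_unique[of x M N y N' y'] off[of x] by (auto simp: mem_points_on mem_lines_through)
  next
    fix p
    assume "p \<in> ?T"
    then show "(snd \<circ> snd) p \<in> Q"
      by auto
  next
    fix x
    assume x: "x \<in> Q"
    then obtain N y where "(x, N) \<in> inc S" "(y, N) \<in> inc S" "(y, M) \<in> inc S"
      using proj_ex M Q off by blast
    then have "(y, N, x) \<in> ?T"
      using x off by (auto simp: mem_points_on mem_lines_through)
    then show "\<exists>p\<in>?T. x = (snd \<circ> snd) p"
      by force
  qed
  then have "card Q = card ?T"
    using bij_betw_same_card by metis
  also have "\<dots> = (\<Sum>y\<in>points_on S M. \<Sum>N\<in>lines_through S y - {M}. card (points_on S N \<inter> Q))"
    using finite_points_on finite_lines_through by (simp add: card_SigmaI finite_SigmaI)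
  finally show ?thesis .
qed

lemma card_pts: "card (pts S) = (s + 1) * (s * t + 1)"
proof -
  obtain M where M: "M \<in> lns S"
    using geometry by (auto simp: point_line_geometry_def)
  let ?Q = "pts S - points_on S M"
  have "card (points_on S N \<inter> ?Q) = s" if "y \<in> points_on S M" "N \<in> lines_through S y - {M}" for y N
  proof -
    have N: "N \<in> lns S" and yN: "(y, N) \<in> inc S" "(y, M) \<in> inc S" "N \<noteq> M"
      using that incD by (auto simp: mem_points_on mem_lines_through)
    have "points_on S N \<inter> ?Q = points_on S N - {y}"
    proof -
      have "(x, M) \<in> inc S \<longleftrightarrow> x = y" if "(x, N) \<in> inc S" for x
        using yN join_unique[of y N x M] that by blast
      then show ?thesis
        by (auto simp: mem_points_on dest: incD(1))
    qed
    then show ?thesis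
      using card_points_on[OF N] yN by (simp add: mem_points_on)
  qed
  moreover have "card (lines_through S y - {M}) = t" if "y \<in> points_on S M" for y
    using that card_lines_through incD by (auto simp: mem_points_on mem_lines_through)
  moreover have "card ?Q = (\<Sum>y\<in>points_on S M. \<Sum>N\<in>lines_through S y - {M}. card (points_on S N \<inter> ?Q))"
    by (rule card_off_line) (use M in \<open>auto simp: mem_points_on\<close>)
  ultimately have "card ?Q = (s + 1) * (t * s)"
    using card_points_on[OF M] by simp
  moreover have "card (pts S) = card (points_on S M) + card ?Q"
    using finite_pts by (metis (no_types, lifting) card_Diff_subset card_mono finite_points_on
        le_add_diff_inverse mem_points_on incD(1) subsetI)
  ultimately show ?thesis
    using card_points_on[OF M] by simp
qed

end

section \<open>Labellings by two bits\<close>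

text \<open>
  The cell of \<open>x\<close> has coordinates \<open>rb x\<close> and \<open>cb x\<close>. The lines of one \<open>kind\<close>, called rows, have
  constant \<open>rb\<close>, the others constant \<open>cb\<close>; this constant value is \<open>lb\<close>.
\<close>

locale bisected_quadrangle = finite_quadrangle S s t
  for S :: "('p, 'l) geometry" and s t :: nat +
  fixes rb cb :: "'p \<Rightarrow> bool" and kind lb :: "'l \<Rightarrow> bool"
  assumes row: "\<lbrakk>(x, M) \<in> inc S; kind M\<rbrakk> \<Longrightarrow> rb x = lb M"
    and col: "\<lbrakk>(x, M) \<in> inc S; \<not> kind M\<rbrakk> \<Longrightarrow> cb x = lb M"
    and cell_nonempty: "\<exists>x\<in>pts S. rb x = u \<and> cb x = v"
    and line_class_nonempty: "\<exists>M\<in>lns S. kind M = k \<and> lb M = u"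

text \<open>Rows and columns are interchangeable; statements about columns are obtained below by
  instantiating those about rows at this labelling.\<close>

lemma (in bisected_quadrangle) bisected_swap:
  "bisected_quadrangle S s t cb rb (\<lambda>M. \<not> kind M) lb"
proof
  show "\<exists>M\<in>lns S. (\<not> kind M) = k \<and> lb M = u" for k u
    using line_class_nonempty[of "\<not> k" u] by auto
qed (use row col cell_nonempty in \<open>auto simp: conj_commute\<close>)

context bisected_quadrangle
begin

definition cell :: "bool \<Rightarrow> bool \<Rightarrow> 'p set" where
  "cell u v = {x \<in> pts S. rb x = u \<and> cb x = v}"

definition line_class :: "bool \<Rightarrow> bool \<Rightarrow> 'l set" where
  "line_class k u = {M \<in> lns S. kind M = k \<and> lb M = u}"

text \<open>
  The choices of a row and of a point in the next two definitions are immaterial, by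
  \<open>card_row_points\<close> and \<open>card_degree\<close>.
\<close>

definition row_points :: "bool \<Rightarrow> nat" where
  "row_points v = card {x. (x, SOME M. M \<in> line_class True True) \<in> inc S \<and> cb x = v}"

definition row_degree :: "bool \<Rightarrow> bool \<Rightarrow> nat" where
  "row_degree u v = card {M. (SOME x. x \<in> cell u v, M) \<in> inc S \<and> kind M}"

section \<open>Constancy and positivity of the local counts\<close>

lemma finite_cell: "finite (cell u v)"
  using finite_pts by (simp add: cell_def)

lemma finite_line_class: "finite (line_class k u)"
  using finite_lns by (simp add: line_class_def)

lemma finite_inc: "finite {x. (x, M) \<in> inc S \<and> P x}" "finite {M. (x, M) \<in> inc S \<and> Q M}"
  using finite_subset[OF _ finite_pts] finite_subset[OF _ finite_lns] incD
  by (metis (mono_tags, lifting) mem_Collect_eq subsetI)+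

lemma ex_cell: "\<exists>x. x \<in> cell u v"
  using cell_nonempty by (auto simp: cell_def)

lemma ex_line_class: "\<exists>M. M \<in> line_class k u"
  using line_class_nonempty by (auto simp: line_class_def)

text \<open>Rows with different labels are disjoint, and a transversal of them contains points with
  different \<open>rb\<close>. It is thus a column, so projection preserves
  \<open>cb\<close>.\<close>

lemma card_opposite_rows:
  assumes M: "M \<in> line_class True u" and N: "N \<in> line_class True (\<not> u)"
  shows "card {x. (x, M) \<in> inc S \<and> cb x = v} = card {y. (y, N) \<in> inc S \<and> cb y = v}"
proof (rule card_points_disjoint_lines)
  show "M \<in> lns S" "N \<in> lns S"
    using M N by (auto simp: line_class_def)
  have rb: "(x, M) \<in> inc S \<Longrightarrow> rb x = u" "(y, N) \<in> inc S \<Longrightarrow> rb y = (\<not> u)" for x y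
    using M N row by (auto simp: line_class_def)
  show "(x, N) \<notin> inc S" if "(x, M) \<in> inc S" for x
    using rb that by blast
  show "cb x = v \<longleftrightarrow> cb y = v"
    if "(x, M) \<in> inc S" "(y, N) \<in> inc S" "(x, K) \<in> inc S" "(y, K) \<in> inc S" for x y K
  proof -
    have "\<not> kind K"
      using rb(1)[OF that(1)] rb(2)[OF that(2)] row[OF that(3)] row[OF that(4)] by auto
    then show ?thesis
      using col that by metis
  qed
qed

text \<open>Two rows with the same label need not be disjoint, so they are compared through a row
  with the other label.\<close>

lemma card_row_points:
  assumes "M \<in> line_class True u"
  shows "card {x. (x, M) \<in> inc S \<and> cb x = v} = row_points v"
proof -
  define M0 where "M0 = (SOME M. M \<in> line_class True True)"
  have M0: "M0 \<in> line_class True True"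
    unfolding M0_def using ex_line_class by (rule someI_ex)
  obtain N where N: "N \<in> line_class True False"
    using ex_line_class by blast
  have *: "card {x. (x, N) \<in> inc S \<and> cb x = v} = row_points v"
    using card_opposite_rows[OF M0, of N v] N by (simp add: row_points_def M0_def)
  show ?thesis
  proof (cases u)
    case True
    then show ?thesis
      using card_opposite_rows[of M True N v] assms N * by simp
  next
    case False
    then show ?thesis
      using card_opposite_rows[OF M0, of M v] assms by (simp add: row_points_def M0_def)
  qed
qed

text \<open>A point with \<open>cb\<close> equal to \<open>v\<close> and the other value of
  \<open>rb\<close> is off the row. The line projecting it onto the row changes \<open>rb\<close>,
  hence is a column and keeps \<open>cb\<close>.\<close>

lemma row_points_pos: "1 \<le> row_points v"
proof -
  obtain M where M: "M \<in> line_class True True"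
    using ex_line_class by blast
  obtain x where x: "x \<in> cell False v"
    using ex_cell by blast
  have "(x, M) \<notin> inc S"
    using M x row by (auto simp: line_class_def cell_def)
  then obtain K y where K: "(x, K) \<in> inc S" "(y, K) \<in> inc S" "(y, M) \<in> inc S"
    using proj_ex M x unfolding line_class_def cell_def by blast
  have "rb y"
    using K(3) M row by (auto simp: line_class_def)
  then have "\<not> kind K"
    using K x row[OF K(1)] row[OF K(2)] by (auto simp: cell_def)
  then have "cb y = v"
    using K x col[OF K(1)] col[OF K(2)] by (auto simp: cell_def)
  then have "y \<in> {x. (x, M) \<in> inc S \<and> cb x = v}"
    using K by simp
  then have "0 < card {x. (x, M) \<in> inc S \<and> cb x = v}"
    using finite_inc(1)[of M "\<lambda>x. cb x = v"] by (auto simp: card_gt_0_iff)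
  then show ?thesis
    using card_row_points[OF M] by simp
qed

lemma row_points_sum: "row_points True + row_points False = s + 1"
proof -
  obtain M where M: "M \<in> line_class True True"
    using ex_line_class by blast
  have "points_on S M = {x. (x, M) \<in> inc S \<and> cb x = True} \<union> {x. (x, M) \<in> inc S \<and> cb x = False}"
    by (auto simp: mem_points_on)
  moreover have "card (points_on S M) = s + 1"
    using M card_points_on by (simp add: line_class_def)
  ultimately show ?thesis
    using card_Un_disjoint[OF finite_inc(1)[of M "\<lambda>x. cb x = True"] finite_inc(1)[of M "\<lambda>x. cb x = False"]]
      card_row_points[OF M, of True] card_row_points[OF M, of False] by fastforce
qed

text \<open>Meeting lines through \<open>x\<close> and \<open>y\<close> cannot both be rows, as
  \<open>rb\<close> would agree at \<open>x\<close> and \<open>y\<close>, nor both columns, as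
  \<open>cb\<close> would agree. Projection between the two pencils therefore exchanges rows and
  columns.\<close>

lemma card_opposite_cells:
  assumes x: "x \<in> cell u v" and y: "y \<in> cell (\<not> u) (\<not> v)"
  shows "card {M. (x, M) \<in> inc S \<and> kind M = k} = card {N. (y, N) \<in> inc S \<and> kind N = (\<not> k)}"
proof (rule card_lines_noncollinear_points)
  show "x \<in> pts S" "y \<in> pts S"
    using x y by (auto simp: cell_def)
  show "(y, M) \<notin> inc S" if "(x, M) \<in> inc S" for M
    using x y row[of _ M] col[of _ M] that by (cases "kind M") (auto simp: cell_def)
  show "kind M = k \<longleftrightarrow> kind N = (\<not> k)"
    if "(x, M) \<in> inc S" "(y, N) \<in> inc S" "(z, M) \<in> inc S" "(z, N) \<in> inc S" for M N z
  proof -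
    have "kind M \<noteq> kind N"
      using x y row[OF that(1)] row[OF that(2)] row[OF that(3)] row[OF that(4)]
        col[OF that(1)] col[OF that(2)] col[OF that(3)] col[OF that(4)]
      by (auto simp: cell_def)
    then show ?thesis
      by auto
  qed
qed

text \<open>Two points of one cell may be collinear and are compared through a point of the opposite
  cell. Columns get no parameter of their own: there are as many of them through \<open>x\<close> as
  rows through a point of the opposite cell.\<close>

lemma card_degree:
  assumes x: "x \<in> cell u v"
  shows "card {M. (x, M) \<in> inc S \<and> kind M} = row_degree u v"
    and "card {M. (x, M) \<in> inc S \<and> \<not> kind M} = row_degree (\<not> u) (\<not> v)"
proof -
  define x0 where "x0 u v = (SOME x. x \<in> cell u v)" for u v
  have x0: "x0 u v \<in> cell u v" for u v
    unfolding x0_def using ex_cell by (rule someI_ex)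
  have rd: "row_degree u v = card {M. (x0 u v, M) \<in> inc S \<and> kind M}" for u v
    by (simp add: row_degree_def x0_def)
  show "card {M. (x, M) \<in> inc S \<and> \<not> kind M} = row_degree (\<not> u) (\<not> v)"
    using card_opposite_cells[OF x x0, of False] by (simp add: rd)
  show "card {M. (x, M) \<in> inc S \<and> kind M} = row_degree u v"
    using card_opposite_cells[OF x x0, of True] card_opposite_cells[OF x0 x0, of u v True]
    by (simp add: rd)
qed

text \<open>A column with label \<open>\<not> v\<close> avoids \<open>x\<close>, and the line
  projecting \<open>x\<close> onto it changes \<open>cb\<close>, so it is a row.\<close>

lemma row_degree_pos: "1 \<le> row_degree u v"
proof -
  obtain x where x: "x \<in> cell u v"
    using ex_cell by blast
  obtain N where N: "N \<in> line_class False (\<not> v)"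
    using ex_line_class by blast
  have "(x, N) \<notin> inc S"
    using N x col by (auto simp: line_class_def cell_def)
  then obtain K y where K: "(x, K) \<in> inc S" "(y, K) \<in> inc S" "(y, N) \<in> inc S"
    using proj_ex N x unfolding line_class_def cell_def by blast
  have "cb y = (\<not> v)"
    using K(3) N col by (auto simp: line_class_def)
  then have "kind K"
    using K x col[OF K(1)] col[OF K(2)] by (auto simp: cell_def)
  then have "K \<in> {M. (x, M) \<in> inc S \<and> kind M}"
    using K by simp
  then have "0 < card {M. (x, M) \<in> inc S \<and> kind M}"
    using finite_inc(2)[of x kind] by (auto simp: card_gt_0_iff)
  then show ?thesis
    using card_degree(1)[OF x] by simp
qed

lemma row_degree_sum: "row_degree u v + row_degree (\<not> u) (\<not> v) = t + 1"
proof -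
  obtain x where x: "x \<in> cell u v"
    using ex_cell by blast
  have "lines_through S x = {M. (x, M) \<in> inc S \<and> kind M} \<union> {M. (x, M) \<in> inc S \<and> \<not> kind M}"
    by (auto simp: mem_lines_through)
  moreover have "card (lines_through S x) = t + 1"
    using x card_lines_through by (simp add: cell_def)
  ultimately show ?thesis
    using card_Un_disjoint[OF finite_inc(2)[of x "\<lambda>M. kind M"] finite_inc(2)[of x "\<lambda>M. \<not> kind M"]]
      card_degree[OF x] by fastforce
qed

section \<open>Columns, and the sizes of cells and line classes\<close>

definition col_points :: "bool \<Rightarrow> nat" where
  "col_points u = bisected_quadrangle.row_points S rb (\<lambda>M. \<not> kind M) lb u"

lemma cell_swap: "bisected_quadrangle.cell S cb rb v u = cell u v"
  using bisected_quadrangle.cell_def[OF bisected_swap] by (auto simp: cell_def)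

lemma line_class_swap:
  "bisected_quadrangle.line_class S (\<lambda>M. \<not> kind M) lb k u = line_class (\<not> k) u"
  using bisected_quadrangle.line_class_def[OF bisected_swap] by (auto simp: line_class_def)

lemma row_degree_swap:
  "bisected_quadrangle.row_degree S cb rb (\<lambda>M. \<not> kind M) v u = row_degree (\<not> u) (\<not> v)"
proof -
  obtain x where x: "x \<in> cell u v"
    using ex_cell by blast
  then show ?thesis
    using bisected_quadrangle.card_degree(1)[OF bisected_swap, of x v u] card_degree(2)[OF x]
    by (simp add: cell_swap)
qed

lemma card_col_points:
  "M \<in> line_class False v \<Longrightarrow> card {x. (x, M) \<in> inc S \<and> rb x = u} = col_points u"
  using bisected_quadrangle.card_row_points[OF bisected_swap, of M v u]
  by (simp add: line_class_swap col_points_def)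

lemma col_points_pos: "1 \<le> col_points u"
  using bisected_quadrangle.row_points_pos[OF bisected_swap] by (simp add: col_points_def)

lemma col_points_sum: "col_points True + col_points False = s + 1"
  using bisected_quadrangle.row_points_sum[OF bisected_swap] by (simp add: col_points_def)

text \<open>The count is \<open>card_off_line\<close> at a row \<open>M\<close> with the other
  label. Only columns lead from \<open>M\<close> into the cell, so only the
  \<open>row_points v\<close> points of \<open>M\<close> with \<open>cb\<close> equal to
  \<open>v\<close> contribute. Such a point lies in the cell \<open>\<not> u\<close>,
  \<open>v\<close>, hence on \<open>row_degree u (\<not> v)\<close> columns, and each of these has
  \<open>col_points u\<close> points in the cell.\<close>

lemma card_cell: "card (cell u v) = row_points v * row_degree u (\<not> v) * col_points u"
proof -
  obtain M where M: "M \<in> line_class True (\<not> u)"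
    using ex_line_class by blast
  let ?Q = "cell u v"
  have off: "(x, M) \<notin> inc S" if "x \<in> ?Q" for x
    using that M row by (auto simp: cell_def line_class_def)
  have inner: "(\<Sum>N\<in>lines_through S y - {M}. card (points_on S N \<inter> ?Q)) =
      (if cb y = v then row_degree u (\<not> v) * col_points u else 0)" if y: "(y, M) \<in> inc S" for y
  proof -
    have y_cell: "y \<in> cell (\<not> u) (cb y)"
      using y M row incD(1)[OF y] by (auto simp: cell_def line_class_def)
    have "card (points_on S N \<inter> ?Q) = (if cb y = v \<and> \<not> kind N then col_points u else 0)"
      if N: "N \<in> lines_through S y - {M}" for N
    proof (cases "cb y = v \<and> \<not> kind N")
      case True
      have yN: "(y, N) \<in> inc S"
        using N by (simp add: mem_lines_through)
      have "N \<in> line_class False v"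
        using True col[OF yN] incD(2)[OF yN] by (auto simp: line_class_def)
      moreover have "points_on S N \<inter> ?Q = {x. (x, N) \<in> inc S \<and> rb x = u}"
        using True col[OF yN] col[of _ N] incD(1)[of _ N] by (auto simp: mem_points_on cell_def)
      ultimately show ?thesis
        using True card_col_points by simp
    next
      case False
      have yN: "(y, N) \<in> inc S"
        using N by (simp add: mem_lines_through)
      have "points_on S N \<inter> ?Q = {}"
        using False y_cell row[OF yN] row[of _ N] col[OF yN] col[of _ N]
        by (cases "kind N") (auto simp: mem_points_on cell_def)
      then show ?thesis
        using False by auto
    qed
    then have "(\<Sum>N\<in>lines_through S y - {M}. card (points_on S N \<inter> ?Q)) =
        (\<Sum>N\<in>lines_through S y - {M}. if cb y = v \<and> \<not> kind N then col_points u else 0)"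
      by (rule sum.cong[OF refl])
    also have "\<dots> = (if cb y = v then card {N \<in> lines_through S y - {M}. \<not> kind N} * col_points u else 0)"
      using finite_lines_through by (simp add: sum.If_cases Int_def)
    \<comment> \<open>Excluding \<open>M\<close> loses no column, because \<open>M\<close> is a
      row.\<close>
    also have "{N \<in> lines_through S y - {M}. \<not> kind N} = {N. (y, N) \<in> inc S \<and> \<not> kind N}"
      using M by (auto simp: mem_lines_through line_class_def)
    also have "card \<dots> = row_degree u (\<not> cb y)"
      using card_degree(2)[OF y_cell] by simp
    finally show ?thesis
      by auto
  qed
  have "card ?Q = (\<Sum>y\<in>points_on S M. \<Sum>N\<in>lines_through S y - {M}. card (points_on S N \<inter> ?Q))"
    by (rule card_off_line) (use M off in \<open>auto simp: line_class_def cell_def\<close>)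
  also have "\<dots> = (\<Sum>y\<in>points_on S M. if cb y = v then row_degree u (\<not> v) * col_points u else 0)"
    by (rule sum.cong[OF refl]) (simp add: inner mem_points_on)
  also have "\<dots> = card {y \<in> points_on S M. cb y = v} * (row_degree u (\<not> v) * col_points u)"
    using finite_points_on by (simp add: sum.If_cases Int_def)
  also have "{y \<in> points_on S M. cb y = v} = {y. (y, M) \<in> inc S \<and> cb y = v}"
    by (auto simp: mem_points_on)
  finally show ?thesis
    using card_row_points[OF M] by simp
qed

text \<open>Incident pairs between \<open>cell u True\<close> and the rows with label
  \<open>u\<close> are counted twice; the factor \<open>row_points True\<close> of
  \<open>card_cell\<close> is positive and cancels.\<close>

lemma card_row_class: "card (line_class True u) = row_degree u True * row_degree u False * col_points u"
proof -
  have "(\<Sum>x\<in>cell u True. card {M \<in> line_class True u. (x, M) \<in> inc S})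
      = (\<Sum>M\<in>line_class True u. row_points True)"
  proof (rule sum_multicount_gen[OF finite_cell finite_line_class], intro ballI)
    fix M
    assume M: "M \<in> line_class True u"
    have "{x \<in> cell u True. (x, M) \<in> inc S} = {x. (x, M) \<in> inc S \<and> cb x = True}"
      using M row incD(1) by (auto simp: cell_def line_class_def)
    then show "card {x \<in> cell u True. (x, M) \<in> inc S} = row_points True"
      using card_row_points[OF M, of True] by simp
  qed
  moreover have "card {M \<in> line_class True u. (x, M) \<in> inc S} = row_degree u True"
    if x: "x \<in> cell u True" for x
  proof -
    have "{M \<in> line_class True u. (x, M) \<in> inc S} = {M. (x, M) \<in> inc S \<and> kind M}"
      using x row incD(2) by (auto simp: cell_def line_class_def)
    then show ?thesis
      using card_degree(1)[OF x] by simp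
  qed
  ultimately have "card (cell u True) * row_degree u True = card (line_class True u) * row_points True"
    by simp
  then show ?thesis
    using card_cell[of u True] row_points_pos[of True] by (simp add: ac_simps)
qed

lemma card_col_class:
  "card (line_class False v) = row_degree True (\<not> v) * row_degree False (\<not> v) * row_points v"
proof -
  interpret swap: bisected_quadrangle S s t cb rb "\<lambda>M. \<not> kind M" lb
    by (rule bisected_swap)
  \<comment> \<open>Exchanging the two kinds twice restores the original labelling.\<close>
  have "swap.col_points v = row_points v"
    using bisected_quadrangle.col_points_def[OF bisected_swap] by simp
  then show ?thesis
    using swap.card_row_class[of v] by (simp add: line_class_swap row_degree_swap)
qed

lemma card_pts_cells:
  "row_points True * row_degree True False * col_points True
    + row_points False * row_degree True True * col_points True
    + row_points False * row_degree False True * col_points False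
    + row_points True * row_degree False False * col_points False = (s + 1) * (s * t + 1)"
proof -
  have disj: "cell u v \<inter> cell u' v' = {}" if "u \<noteq> u' \<or> v \<noteq> v'" for u v u' v'
    using that by (auto simp: cell_def)
  have "pts S = (cell True True \<union> cell True False) \<union> (cell False False \<union> cell False True)"
    by (auto simp: cell_def)
  also have "card \<dots> = (card (cell True True) + card (cell True False))
      + (card (cell False False) + card (cell False True))"
    by (simp add: card_Un_disjoint finite_cell disj Int_Un_distrib Int_Un_distrib2)
  finally show ?thesis
    using card_pts card_cell by simp
qed

lemma ex_singleton_class:
  "(\<exists>u v. card (cell u v) = 1) \<or> (\<exists>k u. card (line_class k u) = 1)"
proof -
  have degree_sums: "row_degree True True + row_degree False False = t + 1"
    "row_degree True False + row_degree False True = t + 1"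
    using row_degree_sum[of True True] row_degree_sum[of True False] by simp_all
  note four_box_extremal[OF row_points_pos row_points_pos col_points_pos col_points_pos
      row_degree_pos row_degree_pos row_degree_pos row_degree_pos
      row_points_sum col_points_sum degree_sums s_ge_2 t_ge_2 card_pts_cells]
  then show ?thesis
    using card_cell[of True True] card_cell[of True False] card_cell[of False False]
      card_cell[of False True] card_row_class[of True] card_row_class[of False]
      card_col_class[of True] card_col_class[of False]
    by (elim disjE conjE) (simp; blast)+
qed

text \<open>If all row degrees are (t + 1) / 2, the four summands of \<open>card_pts_cells\<close>
  factor as (t + 1) / 2 times (s + 1)(s + 1). Equality with (s + 1)(s t + 1) means (s - 1)(t - 1) =
  0.\<close>

lemma not_balanced:
  assumes "\<And>x. x \<in> pts S \<Longrightarrow> 2 * card {M. (x, M) \<in> inc S \<and> kind M} = t + 1"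
  shows False
proof -
  have d: "2 * row_degree u v = t + 1" for u v
  proof -
    obtain x where "x \<in> cell u v"
      using ex_cell by blast
    then show ?thesis
      using assms[of x] card_degree(1)[of x u v] by (simp add: cell_def)
  qed
  obtain q where q: "row_degree u v = q" "2 * q = t + 1" for u v
    using d by (metis mult_left_cancel zero_neq_numeral)
  have "q * ((row_points True + row_points False) * (col_points True + col_points False))
      = (s + 1) * (s * t + 1)"
    using card_pts_cells by (simp add: q(1) algebra_simps)
  then have "q * (s + 1) = s * t + 1"
    unfolding row_points_sum col_points_sum by (metis Suc_eq_plus1 mult.assoc mult.commute nat.distinct(1) mult_left_cancel)
  then have "(t + 1) * (s + 1) = 2 * (s * t + 1)"
    using q(2) by (metis mult.assoc)
  \<comment> \<open>The shift by 2 avoids truncated subtraction: (s - 1)(t - 1) becomes (s' + 1)(t'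
    + 1), which is positive.\<close>
  moreover obtain s' t' where "s = s' + 2" "t = t' + 2"
    using s_ge_2 t_ge_2 by (metis le_add_diff_inverse2)
  ultimately show False
    by (simp add: algebra_simps)
qed

end

section \<open>Epimorphisms with a singleton line fibre\<close>

lemma dual_simps [simp]:
  "pts (dual S) = lns S" "lns (dual S) = pts S" "(M, x) \<in> inc (dual S) \<longleftrightarrow> (x, M) \<in> inc S"
  by (simp_all add: dual_def)

lemma epimorphism_dual: "epimorphism (dual S) (dual G) g f \<longleftrightarrow> epimorphism S G f g"
  by (auto simp: epimorphism_def morphism_def)

lemma line_fibre_dual: "line_fibre (dual S) f a = point_fibre S f a"
  by (simp add: point_fibre_def line_fibre_def)

lemma finite_quadrangle_if_thick:
  assumes "finite_thick_quadrangle S s t"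
  shows "finite_quadrangle S s t"
proof -
  have q: "quadrangle S"
    using assms quadrangle_if_weak_generalized_polygon by (auto simp: finite_thick_quadrangle_def)
  obtain x M where x: "x \<in> pts S" and M: "M \<in> lns S"
    using quadrangle.geometry[OF q] by (auto simp: point_line_geometry_def)
  have fin: "finite (points_on S M)" "finite (lines_through S x)"
    using assms by (auto simp: finite_thick_quadrangle_def points_on_def lines_through_def)
  obtain X K where "X \<subseteq> points_on S M" "card X = 3" "K \<subseteq> lines_through S x" "card K = 3"
    using assms x M unfolding finite_thick_quadrangle_def thick_def by metis
  then have "3 \<le> card (points_on S M)" "3 \<le> card (lines_through S x)"
    using fin card_mono by metis+
  then have "2 \<le> s" "2 \<le> t"
    using assms x M by (auto simp: finite_thick_quadrangle_def has_order_def)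
  then show ?thesis
    using q assms
    by (simp add: finite_quadrangle_def finite_quadrangle_axioms_def finite_thick_quadrangle_def)
qed

lemma has_order_dual: "has_order S s t \<Longrightarrow> has_order (dual S) t s"
  by (simp add: has_order_def points_on_def lines_through_def)

lemma (in finite_quadrangle) finite_quadrangle_dual: "finite_quadrangle (dual S) t s"
  using quadrangle_dual has_order_dual[OF order] finite_pts finite_lns s_ge_2 t_ge_2
  by (simp add: finite_quadrangle_def finite_quadrangle_axioms_def)

text \<open>The grid of order (1, 1) with cyclic names for its elements and its whole incidence
  relation, so that rotation and duality become renamings.\<close>

definition is_quadrilateral ::
  "('q, 'm) geometry \<Rightarrow> 'q \<Rightarrow> 'q \<Rightarrow> 'q \<Rightarrow> 'q \<Rightarrow> 'm \<Rightarrow> 'm \<Rightarrow> 'm \<Rightarrow> 'm \<Rightarrow> bool" where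
  "is_quadrilateral G a b c d ab bc cd da \<longleftrightarrow>
    distinct [a, b, c, d] \<and> distinct [ab, bc, cd, da] \<and>
    pts G = {a, b, c, d} \<and> lns G = {ab, bc, cd, da} \<and>
    inc G = {(a, ab), (b, ab), (b, bc), (c, bc), (c, cd), (d, cd), (d, da), (a, da)}"

lemma is_quadrilateral_rotate:
  "is_quadrilateral G a b c d ab bc cd da \<Longrightarrow> is_quadrilateral G b c d a bc cd da ab"
  unfolding is_quadrilateral_def by auto

text \<open>The new sides start at \<open>b\<close>, since \<open>b\<close> is what joins
  \<open>ab\<close> and \<open>bc\<close> in the dual.\<close>

lemma is_quadrilateral_dual:
  "is_quadrilateral G a b c d ab bc cd da \<Longrightarrow> is_quadrilateral (dual G) ab bc cd da b c d a"
  unfolding is_quadrilateral_def dual_def by auto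

lemma joining_line_eqI:
  assumes "M \<in> lns G" "(x, M) \<in> inc G" "(y, M) \<in> inc G"
    and "\<And>N. (x, N) \<in> inc G \<Longrightarrow> (y, N) \<in> inc G \<Longrightarrow> N = M"
  shows "joining_line G x y = M"
  unfolding joining_line_def by (rule the_equality) (use assms in \<open>blast+\<close>)

text \<open>A point over \<open>a\<close>, projected onto a line over \<open>bc\<close>, uses a line
  over \<open>ab\<close>, the only image path from \<open>a\<close> to \<open>bc\<close>; so it lies
  on \<open>L\<close>. Likewise for points over \<open>b\<close> and lines over \<open>da\<close>.
  The other fibres follow from projections whose image paths in the 4-cycle are forced in the same
  way.\<close>

lemma class_a_if_singleton_line_fibre:
  assumes S: "finite_quadrangle S s t" and G: "is_quadrilateral G a b c d ab bc cd da"
    and epi: "epimorphism S G f g" and fibre: "line_fibre S g ab = {L}"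
  shows "class_a s S G f g"
proof -
  interpret finite_quadrangle S s t
    by (rule S)
  have distG: "distinct [a, b, c, d] \<and> distinct [ab, bc, cd, da]"
    and ptsG: "pts G = {a, b, c, d}" and lnsG: "lns G = {ab, bc, cd, da}"
    and incG: "inc G = {(a, ab), (b, ab), (b, bc), (c, bc), (c, cd), (d, cd), (d, da), (a, da)}"
    using G unfolding is_quadrilateral_def by iprover+
  have dist: "a \<noteq> b" "a \<noteq> c" "a \<noteq> d" "b \<noteq> c" "b \<noteq> d" "c \<noteq> d"
      "ab \<noteq> bc" "ab \<noteq> cd" "ab \<noteq> da" "bc \<noteq> cd" "bc \<noteq> da" "cd \<noteq> da"
    using distG by auto
  have incGab: "(q, ab) \<in> inc G \<longleftrightarrow> q = a \<or> q = b" and incGbc: "(q, bc) \<in> inc G \<longleftrightarrow> q = b \<or> q = c"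
    and incGda: "(q, da) \<in> inc G \<longleftrightarrow> q = d \<or> q = a" for q
    using dist by (auto simp: incG)
  have ncol: "(a, N) \<in> inc G \<Longrightarrow> (c, N) \<notin> inc G" "(b, N) \<in> inc G \<Longrightarrow> (d, N) \<notin> inc G" for N
    using dist by (auto simp: incG)
  have fg: "(f x, g M) \<in> inc G" if "(x, M) \<in> inc S" for x M
    using epi that by (auto simp: epimorphism_def morphism_def)
  have f_surj: "\<exists>x\<in>pts S. f x = q" if "q \<in> pts G" for q
    using epi that unfolding epimorphism_def by (metis imageE)
  have g_surj: "\<exists>M\<in>lns S. g M = N" if "N \<in> lns G" for N
    using epi that unfolding epimorphism_def by (metis imageE)
  have f_pts: "f x \<in> {a, b, c, d}" if "x \<in> pts S" for x
    using epi that ptsG by (auto simp: epimorphism_def)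
  have g_lns: "g M \<in> {ab, bc, cd, da}" if "M \<in> lns S" for M
    using epi that lnsG by (auto simp: epimorphism_def)
  have L: "L \<in> lns S" "g L = ab"
    using fibre by (auto simp: line_fibre_def)
  have L_uniq: "M = L" if "M \<in> lns S" "g M = ab" for M
    using fibre that by (auto simp: line_fibre_def)
  obtain xa xb Mbc Mda where xa: "xa \<in> pts S" "f xa = a" and xb: "xb \<in> pts S" "f xb = b"
    and Mbc: "Mbc \<in> lns S" "g Mbc = bc" and Mda: "Mda \<in> lns S" "g Mda = da"
    using f_surj[of a] f_surj[of b] g_surj[of bc] g_surj[of da] ptsG lnsG by auto
  have proj: "\<exists>N y. (x, N) \<in> inc S \<and> (y, N) \<in> inc S \<and> (y, M) \<in> inc S \<and>
      (f x, g N) \<in> inc G \<and> (f y, g N) \<in> inc G \<and> (f y, g M) \<in> inc G"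
    if "x \<in> pts S" "M \<in> lns S" "(f x, g M) \<notin> inc G" for x M
  proof -
    have "(x, M) \<notin> inc S"
      using fg that by blast
    then show ?thesis
      using proj_ex[of x M] fg that by blast
  qed
  have on_L: "(x, L) \<in> inc S \<longleftrightarrow> f x = a \<or> f x = b" if x: "x \<in> pts S" for x
  proof
    assume "(x, L) \<in> inc S"
    then show "f x = a \<or> f x = b"
      using fg[of x L] L incGab by simp
  next
    assume "f x = a \<or> f x = b"
    then obtain N where "(x, N) \<in> inc S" "g N = ab"
    proof
      assume fx: "f x = a"
      then have "(f x, g Mbc) \<notin> inc G"
        using Mbc incGbc dist by simp
      then obtain N y where N: "(x, N) \<in> inc S" "(f x, g N) \<in> inc G" "(f y, g N) \<in> inc G"
        "(f y, g Mbc) \<in> inc G"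
        using proj x Mbc(1) by blast
      then have "f y = b"
        using fx ncol Mbc incGbc by auto
      then have "g N = ab"
        using N fx dist by (auto simp: incG)
      then show thesis
        using N that by blast
    next
      assume fx: "f x = b"
      then have "(f x, g Mda) \<notin> inc G"
        using Mda incGda dist by simp
      then obtain N y where N: "(x, N) \<in> inc S" "(f x, g N) \<in> inc G" "(f y, g N) \<in> inc G"
        "(f y, g Mda) \<in> inc G"
        using proj x Mda(1) by blast
      then have "f y = a"
        using fx ncol Mda incGda by auto
      then have "g N = ab"
        using N fx dist by (auto simp: incG)
      then show thesis
        using N that by blast
    qed
    then show "(x, L) \<in> inc S"
      using L_uniq incD by blast
  qed
  \<comment> \<open>A line is shown to contain a point over \<open>q\<close> by projecting onto it a
    point over some \<open>q'\<close> off its image, where \<open>q\<close> is the only point of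
    \<open>g M\<close> that can be collinear with \<open>q'\<close>.\<close>
  have meets: "\<exists>y. (y, M) \<in> inc S \<and> f y = q"
    if "M \<in> lns S" "q' \<in> pts G" "(q', g M) \<notin> inc G"
      "\<And>r N. \<lbrakk>(r, g M) \<in> inc G; (r, N) \<in> inc G; (q', N) \<in> inc G\<rbrakk> \<Longrightarrow> r = q" for M q q'
  proof -
    obtain x where "x \<in> pts S" "f x = q'"
      using f_surj \<open>q' \<in> pts G\<close> by blast
    then show ?thesis
      using proj[of x M] that by blast
  qed
  define A B C D where defs: "A = point_fibre S f a" "B = point_fibre S f b"
    "C = point_fibre S f c" "D = point_fibre S f d"
  have mem: "x \<in> A \<longleftrightarrow> x \<in> pts S \<and> f x = a" "x \<in> B \<longleftrightarrow> x \<in> pts S \<and> f x = b"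
    "x \<in> C \<longleftrightarrow> x \<in> pts S \<and> f x = c" "x \<in> D \<longleftrightarrow> x \<in> pts S \<and> f x = d" for x
    by (auto simp: defs point_fibre_def)
  have col_inc: "\<exists>N. (f x, N) \<in> inc G \<and> (f y, N) \<in> inc G" if "collinear S x y" for x y
    using that fg by (auto simp: collinear_def)
  have AB: "A \<union> B = points_on S L"
    by (rule set_eqI) (metis Un_iff mem(1,2) mem_points_on on_L incD(1))
  have disj: "A \<inter> B = {}"
    using dist by (auto simp: mem)
  have finAB: "finite A" "finite B"
    using finite_pts by (auto simp: defs point_fibre_def)
  have "card A + card B = s + 1"
    using card_Un_disjoint[OF finAB disj] AB card_points_on[OF L(1)] by simp
  moreover have "1 \<le> card A" "1 \<le> card B"
    using finAB xa xb mem by (metis card_0_eq empty_iff not_less_eq_eq One_nat_def le0 not_le less_one)+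
  ultimately have cards: "1 \<le> card A" "card A \<le> s" "1 \<le> card B" "card B \<le> s"
    by auto
  have proj_L: "\<exists>y. (y, L) \<in> inc S \<and> collinear S x y" if "x \<in> pts S" "(x, L) \<notin> inc S" for x
    using proj_ex[OF that(1) L(1) that(2)] incD unfolding collinear_def by blast
  have C: "C = {x \<in> pts S. (x, L) \<notin> inc S \<and> (\<exists>y\<in>B. collinear S x y)}"
  proof (intro equalityI subsetI CollectI conjI)
    fix x
    assume x: "x \<in> C"
    then show "x \<in> pts S" "(x, L) \<notin> inc S"
      using on_L dist by (auto simp: mem)
    then obtain y where y: "(y, L) \<in> inc S" "collinear S x y"
      using proj_L by blast
    then have "y \<in> B"
      using on_L[of y] incD(1)[OF y(1)] col_inc[OF y(2)] x ncol by (auto simp: mem)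
    then show "\<exists>y\<in>B. collinear S x y"
      using y by blast
  next
    fix x
    assume "x \<in> {x \<in> pts S. (x, L) \<notin> inc S \<and> (\<exists>y\<in>B. collinear S x y)}"
    then obtain y where x: "x \<in> pts S" "(x, L) \<notin> inc S" and y: "y \<in> B" "collinear S x y"
      by blast
    then show "x \<in> C"
      using f_pts[OF x(1)] on_L[OF x(1)] col_inc[OF y(2)] ncol by (auto simp: mem)
  qed
  have D: "D = {x \<in> pts S. (x, L) \<notin> inc S \<and> (\<exists>y\<in>A. collinear S x y)}"
  proof (intro equalityI subsetI CollectI conjI)
    fix x
    assume x: "x \<in> D"
    then show "x \<in> pts S" "(x, L) \<notin> inc S"
      using on_L dist by (auto simp: mem)
    then obtain y where y: "(y, L) \<in> inc S" "collinear S x y"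
      using proj_L by blast
    then have "y \<in> A"
      using on_L[of y] incD(1)[OF y(1)] col_inc[OF y(2)] x ncol by (auto simp: mem)
    then show "\<exists>y\<in>A. collinear S x y"
      using y by blast
  next
    fix x
    assume "x \<in> {x \<in> pts S. (x, L) \<notin> inc S \<and> (\<exists>y\<in>A. collinear S x y)}"
    then obtain y where x: "x \<in> pts S" "(x, L) \<notin> inc S" and y: "y \<in> A" "collinear S x y"
      by blast
    then show "x \<in> D"
      using f_pts[OF x(1)] on_L[OF x(1)] col_inc[OF y(2)] ncol by (auto simp: mem)
  qed
  have j: "joining_line G a b = ab" "joining_line G b c = bc" "joining_line G a d = da"
    "joining_line G c d = cd"
    by (rule joining_line_eqI; use dist lnsG incG in auto)+
  have f_bc: "line_fibre S g bc = {M \<in> lns S. M \<noteq> L \<and> (\<exists>y\<in>B. (y, M) \<in> inc S)}"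
  proof (intro equalityI subsetI CollectI conjI)
    fix M
    assume "M \<in> line_fibre S g bc"
    then show M: "M \<in> lns S" and "M \<noteq> L"
      using L dist by (auto simp: line_fibre_def)
    have "g M = bc"
      using \<open>M \<in> line_fibre S g bc\<close> by (simp add: line_fibre_def)
    then have "\<exists>y. (y, M) \<in> inc S \<and> f y = b"
      by (intro meets[OF M, of a]) (use dist in \<open>auto simp: incG ptsG\<close>)
    then show "\<exists>y\<in>B. (y, M) \<in> inc S"
      using incD mem by blast
  next
    fix M
    assume "M \<in> {M \<in> lns S. M \<noteq> L \<and> (\<exists>y\<in>B. (y, M) \<in> inc S)}"
    then obtain y where M: "M \<in> lns S" "M \<noteq> L" and y: "f y = b" "(y, M) \<in> inc S"
      by (auto simp: mem)
    then have "g M \<noteq> ab" "(b, g M) \<in> inc G"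
      using L_uniq fg[OF y(2)] by auto
    then show "M \<in> line_fibre S g bc"
      using M dist by (auto simp: line_fibre_def incG)
  qed
  have f_da: "line_fibre S g da = {M \<in> lns S. M \<noteq> L \<and> (\<exists>y\<in>A. (y, M) \<in> inc S)}"
  proof (intro equalityI subsetI CollectI conjI)
    fix M
    assume "M \<in> line_fibre S g da"
    then show M: "M \<in> lns S" and "M \<noteq> L"
      using L dist by (auto simp: line_fibre_def)
    have "g M = da"
      using \<open>M \<in> line_fibre S g da\<close> by (simp add: line_fibre_def)
    then have "\<exists>y. (y, M) \<in> inc S \<and> f y = a"
      by (intro meets[OF M, of b]) (use dist in \<open>auto simp: incG ptsG\<close>)
    then show "\<exists>y\<in>A. (y, M) \<in> inc S"
      using incD mem by blast
  next
    fix M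
    assume "M \<in> {M \<in> lns S. M \<noteq> L \<and> (\<exists>y\<in>A. (y, M) \<in> inc S)}"
    then obtain y where M: "M \<in> lns S" "M \<noteq> L" and y: "f y = a" "(y, M) \<in> inc S"
      by (auto simp: mem)
    then have "g M \<noteq> ab" "(a, g M) \<in> inc G"
      using L_uniq fg[OF y(2)] by auto
    then show "M \<in> line_fibre S g da"
      using M dist by (auto simp: line_fibre_def incG)
  qed
  have f_cd: "line_fibre S g cd =
      {M \<in> lns S. (\<exists>x\<in>C. (x, M) \<in> inc S) \<and> (\<exists>y\<in>D. (y, M) \<in> inc S)}"
  proof (intro equalityI subsetI CollectI conjI)
    fix M
    assume M_in: "M \<in> line_fibre S g cd"
    then show M: "M \<in> lns S"
      by (auto simp: line_fibre_def)
    have gM: "g M = cd"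
      using M_in by (simp add: line_fibre_def)
    have "\<exists>y. (y, M) \<in> inc S \<and> f y = c"
      by (intro meets[OF M, of b]) (use dist gM in \<open>auto simp: incG ptsG\<close>)
    then show "\<exists>x\<in>C. (x, M) \<in> inc S"
      using incD mem by blast
    have "\<exists>y. (y, M) \<in> inc S \<and> f y = d"
      by (intro meets[OF M, of a]) (use dist gM in \<open>auto simp: incG ptsG\<close>)
    then show "\<exists>y\<in>D. (y, M) \<in> inc S"
      using incD mem by blast
  next
    fix M
    assume "M \<in> {M \<in> lns S. (\<exists>x\<in>C. (x, M) \<in> inc S) \<and> (\<exists>y\<in>D. (y, M) \<in> inc S)}"
    then obtain x y where M: "M \<in> lns S" and x: "f x = c" "(x, M) \<in> inc S"
      and y: "f y = d" "(y, M) \<in> inc S"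
      by (auto simp: mem)
    then have "(c, g M) \<in> inc G" "(d, g M) \<in> inc G"
      using fg by metis+
    then show "M \<in> line_fibre S g cd"
      using M dist by (auto simp: line_fibre_def incG)
  qed
  have colG: "collinear G a b" "collinear G b c" "collinear G c d" "collinear G d a"
    by (auto simp: collinear_def lnsG incG)
  show ?thesis
    unfolding class_a_def Let_def
    using dist ptsG colG cards AB disj C D fibre f_bc f_da f_cd L(1)
    by (intro exI[of _ a] exI[of _ b] exI[of _ c] exI[of _ d] conjI bexI[of _ L])
      (simp_all only: j defs[symmetric] distinct.simps list.set insert_iff empty_iff HOL.simp_thms)
qed

section \<open>Epimorphisms onto grids\<close>

text \<open>This covers the grids of all orders (s', 1) at once: two lines on every point, and by
  \<open>other_point\<close> at least two points on every line.\<close>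

locale dual_thin_quadrangle = quadrangle G for G :: "('q, 'm) geometry" +
  assumes card_lines_through: "x \<in> pts G \<Longrightarrow> card (lines_through G x) = 2"
    and other_point: "\<lbrakk>x \<in> pts G; M \<in> lns G\<rbrakk> \<Longrightarrow> \<exists>y. (y, M) \<in> inc G \<and> y \<noteq> x"
begin

section \<open>Parallel classes and the induced labelling\<close>

lemma third_line:
  assumes "(x, M) \<in> inc G" "(x, N) \<in> inc G" "M \<noteq> N" "(x, K) \<in> inc G"
  shows "K = M \<or> K = N"
proof (rule ccontr)
  assume "\<not> (K = M \<or> K = N)"
  then have "card {K, M, N} = 3"
    using \<open>M \<noteq> N\<close> by simp
  moreover have "{K, M, N} \<subseteq> lines_through G x"
    using assms incD by (auto simp: lines_through_def)
  moreover have "finite (lines_through G x)"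
    using card_lines_through[of x] incD(1)[OF assms(1)] by (metis card.infinite zero_neq_numeral)
  ultimately have "3 \<le> card (lines_through G x)"
    using card_mono by metis
  then show False
    using card_lines_through[of x] incD(1)[OF assms(1)] by simp
qed

lemma other_line:
  assumes "(x, M) \<in> inc G"
  shows "\<exists>N. (x, N) \<in> inc G \<and> N \<noteq> M"
proof (rule ccontr)
  assume "\<not> ?thesis"
  then have "lines_through G x \<subseteq> {M}"
    by (auto simp: lines_through_def)
  then have "card (lines_through G x) \<le> 1"
    using card_mono[of "{M}" "lines_through G x"] by simp
  then show False
    using card_lines_through[of x] incD(1)[OF assms] by simp
qed

definition parallel :: "'m \<Rightarrow> 'm \<Rightarrow> bool" where
  "parallel L M \<longleftrightarrow> M = L \<or> (\<forall>x. (x, M) \<in> inc G \<longrightarrow> (x, L) \<notin> inc G)"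

text \<open>Of the two lines through a point off \<open>L\<close>, exactly one is the line
  projecting the point onto \<open>L\<close>. Of those through a point of \<open>L\<close>, one is
  \<open>L\<close> and the other meets it. This is the colouring of the lines by rows and
  columns.\<close>

lemma parallel_concurrent:
  assumes L: "L \<in> lns G" and z: "(z, M) \<in> inc G" "(z, N) \<in> inc G" and ne: "M \<noteq> N"
  shows "parallel L M \<noteq> parallel L N"
proof
  assume eq: "parallel L M = parallel L N"
  show False
  proof (cases "parallel L M")
    case True
    then have "(z, L) \<notin> inc G"
      using eq z ne unfolding parallel_def by metis
    then obtain K y where K: "(z, K) \<in> inc G" "(y, K) \<in> inc G" "(y, L) \<in> inc G"
      using proj_ex L incD(1)[OF z(1)] by blast
    then have "K = M \<or> K = N"
      using third_line z ne by blast
    then have "\<not> parallel L K \<or> K = L"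
      using K unfolding parallel_def by blast
    then show False
      using True eq \<open>K = M \<or> K = N\<close> \<open>(z, L) \<notin> inc G\<close> z by blast
  next
    case False
    obtain x where x: "(x, M) \<in> inc G" "(x, L) \<in> inc G" and "M \<noteq> L"
      using False unfolding parallel_def by blast
    obtain y where y: "(y, N) \<in> inc G" "(y, L) \<in> inc G" and "N \<noteq> L"
      using False eq unfolding parallel_def by blast
    show False
    proof (cases "(z, L) \<in> inc G")
      case True
      then show False
        using third_line[OF z ne True] \<open>M \<noteq> L\<close> \<open>N \<noteq> L\<close> by blast
    next
      case False
      then show False
        using proj_unique[OF False z(1) x z(2) y] ne by blast
    qed
  qed
qed

lemma parallel_refl: "parallel L L"
  by (simp add: parallel_def)

lemma not_parallel_concurrent:
  "\<lbrakk>(z, L) \<in> inc G; (z, M) \<in> inc G; M \<noteq> L\<rbrakk> \<Longrightarrow> \<not> parallel L M"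
  by (auto simp: parallel_def)

text \<open>The grid is collapsed to a 2 by 2 pattern: \<open>L\<close> is singled out among the
  rows and \<open>M\<close> among the columns. Since \<open>M\<close> is not parallel to
  \<open>L\<close>, the one label \<open>g N = L \<or> g N = M\<close> serves both kinds of
  lines.\<close>

lemma bisected_quadrangle_if_epimorphism:
  assumes S: "finite_quadrangle S s t" and epi: "epimorphism S G f g"
    and a: "(a, L) \<in> inc G" "(a, M) \<in> inc G" and LM: "L \<noteq> M"
  shows "bisected_quadrangle S s t (\<lambda>x. (f x, L) \<in> inc G) (\<lambda>x. (f x, M) \<in> inc G)
    (\<lambda>N. parallel L (g N)) (\<lambda>N. g N = L \<or> g N = M)"
proof -
  have L: "L \<in> lns G" and M: "M \<in> lns G" and aG: "a \<in> pts G"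
    using a incD by auto
  have fg: "(f x, g N) \<in> inc G" if "(x, N) \<in> inc S" for x N
    using epi that by (auto simp: epimorphism_def morphism_def)
  have f_surj: "\<exists>x\<in>pts S. f x = q" if "q \<in> pts G" for q
    using epi that unfolding epimorphism_def by (metis imageE)
  have g_surj: "\<exists>N\<in>lns S. g N = K" if "K \<in> lns G" for K
    using epi that unfolding epimorphism_def by (metis imageE)
  have parM: "\<not> parallel L M"
    using not_parallel_concurrent a LM by blast
  obtain b where b: "(b, L) \<in> inc G" "b \<noteq> a"
    using other_point aG L by blast
  obtain d where d: "(d, M) \<in> inc G" "d \<noteq> a"
    using other_point aG M by blast
  have bM: "(b, M) \<notin> inc G" and dL: "(d, L) \<notin> inc G"
    using join_unique[OF a(1) b(1) a(2)] join_unique[OF a(2) d(1) a(1)] b d LM by auto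
  obtain Mb where Mb: "(b, Mb) \<in> inc G" "Mb \<noteq> L"
    using other_line b(1) by blast
  obtain Md where Md: "(d, Md) \<in> inc G" "Md \<noteq> M"
    using other_line d(1) by blast
  have parMb: "\<not> parallel L Mb"
    using not_parallel_concurrent b(1) Mb by blast
  have parMd: "parallel L Md"
    using parallel_concurrent[OF L d(1) Md(1)] Md(2) parM by blast
  \<comment> \<open>\<open>c\<close> represents the cell off both reference lines: \<open>Mb\<close>
    meets \<open>L\<close> only in \<open>b\<close>, and as another column it is disjoint from
    \<open>M\<close>.\<close>
  obtain c where c: "(c, Mb) \<in> inc G" "c \<noteq> b"
    using other_point[OF incD[OF Mb(1)]] by blast
  have cL: "(c, L) \<notin> inc G"
    using join_unique[OF b(1) _ Mb(1) c(1)] c Mb by blast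
  have cM: "(c, M) \<notin> inc G"
    using parallel_concurrent[OF L c(1)] parM parMb bM Mb(1) by blast
  have cells: "\<exists>q\<in>pts G. ((q, L) \<in> inc G) = u \<and> ((q, M) \<in> inc G) = v" for u v
    using a b(1) bM c(1) cL cM d(1) dL incD(1) by (cases u; cases v) blast+
  have lines: "\<exists>N\<in>lns G. parallel L N = k \<and> (N = L \<or> N = M) = u" for k u
  proof -
    have "parallel L L \<and> (L = L \<or> L = M)" "\<not> parallel L M \<and> (M = L \<or> M = M)"
      using parM parallel_refl by auto
    moreover have "parallel L Md \<and> \<not> (Md = L \<or> Md = M)" "\<not> parallel L Mb \<and> \<not> (Mb = L \<or> Mb = M)"
      using parMd Md dL parMb Mb bM by auto
    ultimately show ?thesis
      using L M incD(2)[OF Mb(1)] incD(2)[OF Md(1)] by (cases k; cases u) blast+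
  qed
  show ?thesis
    unfolding bisected_quadrangle_def bisected_quadrangle_axioms_def
  proof (intro conjI allI impI S)
    show "((f x, L) \<in> inc G) = (g N = L \<or> g N = M)"
      if "(x, N) \<in> inc S" "parallel L (g N)" for x N
      using fg[OF that(1)] that(2) parM unfolding parallel_def by metis
    \<comment> \<open>Distinct columns are disjoint by \<open>parallel_concurrent\<close>, so a
      point of the column \<open>g N\<close> lies on \<open>M\<close> only if
      \<open>g N = M\<close>.\<close>
    show "((f x, M) \<in> inc G) = (g N = L \<or> g N = M)"
      if "(x, N) \<in> inc S" "\<not> parallel L (g N)" for x N
      using fg[OF that(1)] that(2) parM parallel_refl parallel_concurrent[OF L, of "f x" "g N" M] by metis
    show "\<exists>x\<in>pts S. ((f x, L) \<in> inc G) = u \<and> ((f x, M) \<in> inc G) = v" for u v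
      using cells[of u v] f_surj by metis
    show "\<exists>N\<in>lns S. parallel L (g N) = k \<and> (g N = L \<or> g N = M) = u" for k u
      using lines[of k u] g_surj by metis
  qed
qed

text \<open>The path \<open>d\<close>, \<open>da\<close>, \<open>a\<close>, \<open>ab\<close>,
  \<open>b\<close>, \<open>bc\<close>, \<open>c\<close> is closed by projecting \<open>d\<close>
  onto \<open>bc\<close>. Two points per line and two lines per point leave room for no further
  elements.\<close>

lemma is_quadrilateral_if_two_points:
  assumes two: "\<And>x y z M. \<lbrakk>(x, M) \<in> inc G; (y, M) \<in> inc G; x \<noteq> y; (z, M) \<in> inc G\<rbrakk> \<Longrightarrow> z = x \<or> z = y"
  shows "\<exists>a b c d ab bc cd da. is_quadrilateral G a b c d ab bc cd da"
proof -
  obtain a0 ab where a0: "a0 \<in> pts G" and ab: "ab \<in> lns G"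
    using geometry by (auto simp: point_line_geometry_def)
  obtain a where a_ab: "(a, ab) \<in> inc G"
    using other_point a0 ab by blast
  obtain b where b_ab: "(b, ab) \<in> inc G" "b \<noteq> a"
    using other_point incD[OF a_ab] by blast
  obtain da where da: "(a, da) \<in> inc G" "da \<noteq> ab"
    using other_line a_ab by blast
  obtain bc where bc: "(b, bc) \<in> inc G" "bc \<noteq> ab"
    using other_line b_ab by blast
  obtain d where d: "(d, da) \<in> inc G" "d \<noteq> a"
    using other_point incD[OF da(1)] by blast
  obtain c where c: "(c, bc) \<in> inc G" "c \<noteq> b"
    using other_point incD[OF bc(1)] by blast
  have d_ab: "(d, ab) \<notin> inc G" and c_ab: "(c, ab) \<notin> inc G"
    using join_unique[OF da(1) d(1) a_ab] join_unique[OF bc(1) c(1) b_ab(1)] da bc c d by auto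
  have d_bc: "(d, bc) \<notin> inc G"
    using proj_unique[OF d_ab d(1) da(1) a_ab _ bc(1) b_ab(1)] b_ab by blast
  have c_da: "(c, da) \<notin> inc G"
    using proj_unique[OF c_ab c(1) bc(1) b_ab(1) _ da(1) a_ab] b_ab by blast
  obtain cd y where y: "(d, cd) \<in> inc G" "(y, cd) \<in> inc G" "(y, bc) \<in> inc G"
    using proj_ex[OF incD(1)[OF d(1)] incD(2)[OF bc(1)] d_bc] by blast
  \<comment> \<open>Otherwise \<open>cd\<close> would be \<open>ab\<close> or \<open>bc\<close>, the
    only lines through \<open>b\<close>, and \<open>d\<close> is on neither.\<close>
  have "y \<noteq> b"
    using third_line[OF b_ab(1) bc(1), of cd] bc y d_ab d_bc by blast
  then have "y = c"
    using two[OF bc(1) c(1) _ y(3)] c by blast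
  then have cd: "(c, cd) \<in> inc G" "(d, cd) \<in> inc G"
    using y by auto
  have dist: "distinct [a, b, c, d]"
    using a_ab b_ab c d c_ab d_ab d_bc by auto
  have ldist: "distinct [ab, bc, cd, da]"
    using da bc cd d_ab d_bc c_da d(1) by auto
  have on: "(q, ab) \<in> inc G \<longleftrightarrow> q = a \<or> q = b" "(q, bc) \<in> inc G \<longleftrightarrow> q = b \<or> q = c"
    "(q, cd) \<in> inc G \<longleftrightarrow> q = c \<or> q = d" "(q, da) \<in> inc G \<longleftrightarrow> q = d \<or> q = a" for q
    using two[OF a_ab b_ab(1), of q] two[OF bc(1) c(1), of q] two[OF cd, of q]
      two[OF d(1) da(1), of q] a_ab b_ab da bc c d cd dist by auto
  have pts_sub: "q \<in> {a, b, c, d}" if q: "q \<in> pts G" for q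
  proof (cases "(q, ab) \<in> inc G")
    case True
    then show ?thesis
      using on by blast
  next
    case False
    then obtain N y where N: "(q, N) \<in> inc G" "(y, N) \<in> inc G" "(y, ab) \<in> inc G"
      using proj_ex q ab by blast
    then have "N = da \<or> N = bc"
      using on(1)[of y] third_line[OF a_ab da(1)] third_line[OF b_ab(1) bc(1)] da bc False by blast
    then show ?thesis
      using N on by blast
  qed
  have inc_lns: "N \<in> {ab, bc, cd, da}" if "(q, N) \<in> inc G" for q N
    using pts_sub[OF incD(1)[OF that]] that third_line[OF a_ab da(1)] third_line[OF b_ab(1) bc(1)]
      third_line[OF c(1) cd(1)] third_line[OF d(1) cd(2)] ldist by auto
  have lns_sub: "N \<in> {ab, bc, cd, da}" if N: "N \<in> lns G" for N
    using other_point[OF a0 N] inc_lns by blast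
  have "pts G = {a, b, c, d}"
    using pts_sub incD(1)[OF a_ab] incD(1)[OF b_ab(1)] incD(1)[OF c(1)] incD(1)[OF d(1)] by blast
  moreover have "lns G = {ab, bc, cd, da}"
    using lns_sub ab incD(2)[OF bc(1)] incD(2)[OF cd(1)] incD(2)[OF d(1)] by blast
  moreover have "inc G = {(a, ab), (b, ab), (b, bc), (c, bc), (c, cd), (d, cd), (d, da), (a, da)}"
    (is "_ = ?I")
  proof (intro equalityI subsetI)
    fix p
    assume p: "p \<in> inc G"
    obtain q N where "p = (q, N)"
      by fastforce
    then show "p \<in> ?I"
      using p inc_lns[of q N] on[of q] by auto
  next
    fix p
    assume "p \<in> ?I"
    then show "p \<in> inc G"
      using a_ab b_ab da bc c d cd by blast
  qed
  ultimately have "is_quadrilateral G a b c d ab bc cd da"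
    unfolding is_quadrilateral_def using dist ldist by iprover
  then show ?thesis
    by blast
qed

end

text \<open>In the grid picture these are three points no two of which share a row or a column:
  \<open>q\<close>, and one point on each of the lines crossing \<open>K\<close> at two further
  points \<open>u\<close>, \<open>v\<close>.\<close>

lemma (in dual_thin_quadrangle) ex_noncollinear_triple:
  assumes three: "\<And>x y M. M \<in> lns G \<Longrightarrow> \<exists>z. (z, M) \<in> inc G \<and> z \<noteq> x \<and> z \<noteq> y"
    and q: "q \<in> pts G"
  shows "\<exists>q'\<in>pts G. \<exists>q''\<in>pts G. \<not> collinear G q q' \<and> \<not> collinear G q' q'' \<and> \<not> collinear G q'' q"
proof -
  have "lines_through G q \<noteq> {}"
    using card_lines_through[OF q] by auto
  then obtain K where K: "(q, K) \<in> inc G"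
    by (auto simp: lines_through_def)
  obtain u where u: "(u, K) \<in> inc G" "u \<noteq> q"
    using three[of K q q] incD(2)[OF K] by blast
  obtain v where v: "(v, K) \<in> inc G" "v \<noteq> q" "v \<noteq> u"
    using three[of K q u] incD(2)[OF K] by blast
  obtain U where U: "(u, U) \<in> inc G" "U \<noteq> K"
    using other_line u(1) by blast
  obtain V where V: "(v, V) \<in> inc G" "V \<noteq> K"
    using other_line v(1) by blast
  obtain u' where u': "(u', U) \<in> inc G" "u' \<noteq> u"
    using three[of U u u] incD(2)[OF U(1)] by blast
  have u'K: "(u', K) \<notin> inc G"
    using join_unique[OF U(1) u'(1) u(1)] U u' by blast
  have u'V: "(u', V) \<notin> inc G"
    using proj_unique[OF u'K u'(1) U(1) u(1) _ V(1) v(1)] v by blast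
  obtain N w where w: "(u', N) \<in> inc G" "(w, N) \<in> inc G" "(w, V) \<in> inc G"
    using proj_ex[OF incD(1)[OF u'(1)] incD(2)[OF V(1)] u'V] by blast
  \<comment> \<open>\<open>w\<close> is the only point of \<open>V\<close> collinear with
    \<open>u'\<close>; a third point of \<open>V\<close> avoids both it and
    \<open>v\<close>.\<close>
  obtain z where z: "(z, V) \<in> inc G" "z \<noteq> v" "z \<noteq> w"
    using three[of V v w] incD(2)[OF V(1)] by blast
  have zK: "(z, K) \<notin> inc G"
    using join_unique[OF V(1) z(1) v(1)] V z by blast
  have "\<not> collinear G q u'"
    using proj_unique[OF u'K u'(1) U(1) u(1) _ _ K] u unfolding collinear_def by blast
  moreover have "\<not> collinear G z q"
    using proj_unique[OF zK z(1) V(1) v(1) _ _ K] v unfolding collinear_def by blast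
  moreover have "\<not> collinear G u' z"
    using proj_unique[OF u'V w _ _ z(1)] z unfolding collinear_def by blast
  ultimately show ?thesis
    using incD(1)[OF u'(1)] incD(1)[OF z(1)] by blast
qed

text \<open>If \<open>f x\<close> and \<open>f y\<close> are noncollinear, projection between the
  pencils of \<open>x\<close> and \<open>y\<close> exchanges rows and columns, so
  \<open>\<rho> x = \<gamma> y\<close>. Three such exchanges around a triple of pairwise
  noncollinear images, an odd number, give \<open>\<rho> x = \<gamma> x\<close>, against
  \<open>not_balanced\<close>.\<close>

lemma (in dual_thin_quadrangle) no_epimorphism_if_three_points:
  assumes S: "finite_quadrangle S s t" and epi: "epimorphism S G f g"
    and three: "\<And>x y M. M \<in> lns G \<Longrightarrow> \<exists>z. (z, M) \<in> inc G \<and> z \<noteq> x \<and> z \<noteq> y"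
  shows False
proof -
  obtain a0 L where a0: "a0 \<in> pts G" and L: "L \<in> lns G"
    using geometry by (auto simp: point_line_geometry_def)
  obtain a where a: "(a, L) \<in> inc G"
    using other_point a0 L by blast
  obtain M where M: "(a, M) \<in> inc G" "M \<noteq> L"
    using other_line a by blast
  interpret bisected_quadrangle S s t "\<lambda>x. (f x, L) \<in> inc G" "\<lambda>x. (f x, M) \<in> inc G"
    "\<lambda>N. parallel L (g N)" "\<lambda>N. g N = L \<or> g N = M"
    using bisected_quadrangle_if_epimorphism[OF S epi a M(1)] M(2) by blast
  have fg: "(f x, g N) \<in> inc G" if "(x, N) \<in> inc S" for x N
    using epi that by (auto simp: epimorphism_def morphism_def)
  have f_pts: "f x \<in> pts G" if "x \<in> pts S" for x
    using epi that by (auto simp: epimorphism_def)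
  have f_surj: "\<exists>x\<in>pts S. f x = q" if "q \<in> pts G" for q
    using epi that unfolding epimorphism_def by (metis imageE)
  define \<rho> where "\<rho> x = card {N. (x, N) \<in> inc S \<and> parallel L (g N)}" for x
  define \<gamma> where "\<gamma> x = card {N. (x, N) \<in> inc S \<and> \<not> parallel L (g N)}" for x
  have sum: "\<rho> x + \<gamma> x = t + 1" if x: "x \<in> pts S" for x
  proof -
    have "{N. (x, N) \<in> inc S \<and> parallel L (g N)} \<union> {N. (x, N) \<in> inc S \<and> \<not> parallel L (g N)}
        = lines_through S x"
      by (auto simp: mem_lines_through)
    moreover have "{N. (x, N) \<in> inc S \<and> parallel L (g N)} \<inter> {N. (x, N) \<in> inc S \<and> \<not> parallel L (g N)} = {}"
      by blast
    ultimately show ?thesis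
      using card_Un_disjoint[OF finite_inc(2)[of x "\<lambda>N. parallel L (g N)"]
          finite_inc(2)[of x "\<lambda>N. \<not> parallel L (g N)"]]
        finite_quadrangle.card_lines_through[OF S x]
      by (simp add: \<rho>_def \<gamma>_def)
  qed
  have swap: "\<rho> x = \<gamma> y"
    if x: "x \<in> pts S" and y: "y \<in> pts S" and nc: "\<not> collinear G (f x) (f y)" for x y
    unfolding \<rho>_def \<gamma>_def
  proof (rule card_lines_noncollinear_points[OF x y])
    have far: "(f y, g N) \<notin> inc G" if "(x, N) \<in> inc S" for N
      using fg[OF that] nc incD(2) dual_thin_quadrangle_axioms unfolding collinear_def
      by (metis dual_thin_quadrangle.axioms(1) quadrangle.incD(2))
    show "(y, N) \<notin> inc S" if "(x, N) \<in> inc S" for N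
      using far[OF that] fg by blast
    show "parallel L (g N) = (\<not> parallel L (g N'))"
      if "(x, N) \<in> inc S" "(y, N') \<in> inc S" "(z, N) \<in> inc S" "(z, N') \<in> inc S" for N N' z
    proof -
      have "g N \<noteq> g N'"
        using far[OF that(1)] fg[OF that(2)] by auto
      then show ?thesis
        using parallel_concurrent[OF L fg[OF that(3)] fg[OF that(4)]] by blast
    qed
  qed
  have "2 * \<rho> x = t + 1" if x: "x \<in> pts S" for x
  proof -
    obtain q' q'' where q: "q' \<in> pts G" "q'' \<in> pts G" "\<not> collinear G (f x) q'"
      "\<not> collinear G q' q''" "\<not> collinear G q'' (f x)"
      using ex_noncollinear_triple[OF three f_pts[OF x]] by blast
    obtain y z where "y \<in> pts S" "f y = q'" "z \<in> pts S" "f z = q''"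
      using f_surj q(1,2) by metis
    then show ?thesis
      using swap[OF x, of y] swap[of y z] swap[of z x] sum[OF x] sum[of y] sum[of z] q x by simp
  qed
  then show False
    using not_balanced unfolding \<rho>_def by blast
qed

section \<open>Classification and existence for grids\<close>

lemma dual_thin_quadrangle_if_grid:
  assumes "grid G n"
  shows "dual_thin_quadrangle G"
proof -
  interpret quadrangle G
    using assms quadrangle_if_weak_generalized_polygon by (auto simp: grid_def)
  show ?thesis
  proof
    show "card (lines_through G x) = 2" if "x \<in> pts G" for x
      using assms that by (simp add: grid_def has_order_def)
    show "\<exists>y. (y, M) \<in> inc G \<and> y \<noteq> x" if "M \<in> lns G" for x M
    proof (rule ccontr)
      assume "\<not> ?thesis"
      then have "points_on G M \<subseteq> {x}"
        by (auto simp: points_on_def)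
      then have "card (points_on G M) \<le> 1"
        using card_mono[of "{x}" "points_on G M"] by simp
      then show False
        using assms that by (simp add: grid_def has_order_def)
    qed
  qed
qed

lemma grid_third_point:
  assumes G: "grid G n" and n: "n \<noteq> 1" and M: "M \<in> lns G"
  shows "\<exists>z. (z, M) \<in> inc G \<and> z \<noteq> x \<and> z \<noteq> y"
proof (rule ccontr)
  assume "\<not> ?thesis"
  then have "points_on G M \<subseteq> {x, y}"
    by (auto simp: points_on_def)
  then have "card (points_on G M) \<le> card {x, y}"
    by (rule card_mono[rotated]) simp
  also have "\<dots> \<le> 2"
    by (simp add: card_insert_if)
  finally show False
    using G n M by (simp add: grid_def has_order_def)
qed

lemma is_quadrilateral_if_grid:
  assumes G: "grid G 1"
  shows "\<exists>a b c d ab bc cd da. is_quadrilateral G a b c d ab bc cd da"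
proof -
  interpret dual_thin_quadrangle G
    by (rule dual_thin_quadrangle_if_grid[OF G])
  show ?thesis
  proof (rule is_quadrilateral_if_two_points, rule ccontr)
    fix x y z M
    assume *: "(x, M) \<in> inc G" "(y, M) \<in> inc G" "x \<noteq> y" "(z, M) \<in> inc G" "\<not> (z = x \<or> z = y)"
    have two: "card (points_on G M) = 2"
      using G incD(2)[OF *(1)] by (simp add: grid_def has_order_def)
    then have "finite (points_on G M)"
      using card.infinite by fastforce
    moreover have "{x, y, z} \<subseteq> points_on G M"
      using * incD(1) by (auto simp: points_on_def)
    ultimately have "card {x, y, z} \<le> 2"
      using card_mono two by metis
    then show False
      using * by auto
  qed
qed

text \<open>Rotating the names of the 4-cycle moves any of its lines into the position of
  \<open>ab\<close>.\<close>

lemma class_a_if_some_singleton_line_fibre: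
  assumes S: "finite_quadrangle S s t" and G: "is_quadrilateral G a b c d ab bc cd da"
    and epi: "epimorphism S G f g" and N: "N \<in> {ab, bc, cd, da}" and fibre: "card (line_fibre S g N) = 1"
  shows "class_a s S G f g"
proof -
  obtain L where L: "line_fibre S g N = {L}"
    using fibre card_1_singletonE by blast
  note G1 = is_quadrilateral_rotate[OF G]
  note G2 = is_quadrilateral_rotate[OF G1]
  note G3 = is_quadrilateral_rotate[OF G2]
  show ?thesis
    using N L class_a_if_singleton_line_fibre[OF S G epi] class_a_if_singleton_line_fibre[OF S G1 epi]
      class_a_if_singleton_line_fibre[OF S G2 epi] class_a_if_singleton_line_fibre[OF S G3 epi]
    by blast
qed

text \<open>With reference lines \<open>ab\<close> and \<open>da\<close> the cells are exactly the
  point fibres and the line classes exactly the line fibres, so \<open>ex_singleton_class\<close>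
  yields a singleton fibre of \<open>f\<close> or of \<open>g\<close>. A point fibre is a line fibre
  of the dual epimorphism.\<close>

lemma class_a_or_b:
  assumes S: "finite_quadrangle S s t" and thin: "dual_thin_quadrangle G"
    and G: "is_quadrilateral G a b c d ab bc cd da" and epi: "epimorphism S G f g"
  shows "class_a s S G f g \<or> class_b t S G f g"
proof -
  interpret thin: dual_thin_quadrangle G
    by (rule thin)
  have distG: "distinct [a, b, c, d] \<and> distinct [ab, bc, cd, da]"
    and ptsG: "pts G = {a, b, c, d}" and lnsG: "lns G = {ab, bc, cd, da}"
    and incG: "inc G = {(a, ab), (b, ab), (b, bc), (c, bc), (c, cd), (d, cd), (d, da), (a, da)}"
    using G unfolding is_quadrilateral_def by iprover+
  have dist: "a \<noteq> b" "a \<noteq> c" "a \<noteq> d" "b \<noteq> c" "b \<noteq> d" "c \<noteq> d"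
      "ab \<noteq> bc" "ab \<noteq> cd" "ab \<noteq> da" "bc \<noteq> cd" "bc \<noteq> da" "cd \<noteq> da"
    using distG by auto
  have on: "(q, ab) \<in> inc G \<longleftrightarrow> q = a \<or> q = b" "(q, da) \<in> inc G \<longleftrightarrow> q = d \<or> q = a" for q
    using dist by (auto simp: incG)
  have par: "thin.parallel ab N \<longleftrightarrow> N = ab \<or> N = cd" if "N \<in> {ab, bc, cd, da}" for N
  proof -
    have "(b, bc) \<in> inc G" "(a, da) \<in> inc G" "(a, cd) \<notin> inc G" "(b, cd) \<notin> inc G"
      using dist by (auto simp: incG)
    then show ?thesis
      using that dist unfolding thin.parallel_def on(1) by blast
  qed
  interpret bisected_quadrangle S s t "\<lambda>x. (f x, ab) \<in> inc G" "\<lambda>x. (f x, da) \<in> inc G"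
    "\<lambda>N. thin.parallel ab (g N)" "\<lambda>N. g N = ab \<or> g N = da"
    by (rule thin.bisected_quadrangle_if_epimorphism[OF S epi, of a]) (use dist in \<open>auto simp: incG\<close>)
  have f_pts: "f x \<in> {a, b, c, d}" if "x \<in> pts S" for x
    using epi that ptsG by (auto simp: epimorphism_def)
  have g_lns: "g N \<in> {ab, bc, cd, da}" if "N \<in> lns S" for N
    using epi that lnsG by (auto simp: epimorphism_def)
  have cell: "cell u v = point_fibre S f (if u then if v then a else b else if v then d else c)" for u v
    unfolding cell_def point_fibre_def unfolding on using f_pts dist by auto
  have line_class: "line_class k u = line_fibre S g (if k then if u then ab else cd else if u then da else bc)"
    for k u
  proof -
    have "thin.parallel ab (g N) \<longleftrightarrow> g N = ab \<or> g N = cd" if "N \<in> lns S" for N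
      using par g_lns that by blast
    then show ?thesis
      unfolding line_class_def line_fibre_def using g_lns dist by auto
  qed
  from ex_singleton_class show ?thesis
  proof (elim disjE exE)
    fix k u
    assume "card (line_class k u) = 1"
    then have "class_a s S G f g"
      unfolding line_class by (rule class_a_if_some_singleton_line_fibre[OF S G epi, rotated]) auto
    then show ?thesis ..
  next
    fix u v
    assume "card (cell u v) = 1"
    then have "class_a t (dual S) (dual G) g f"
      unfolding cell line_fibre_dual[symmetric]
      by (rule class_a_if_some_singleton_line_fibre[OF finite_quadrangle_dual is_quadrilateral_dual[OF G]
            epimorphism_dual[THEN iffD2, OF epi], rotated]) auto
    then show ?thesis
      by (simp add: class_b_def)
  qed
qed

text \<open>The map has a single point \<open>p\<close> over \<open>a\<close>, the other points of
  \<open>L\<close> over \<open>b\<close>, and the points off \<open>L\<close> divided by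
  collinearity with \<open>p\<close>. Being an epimorphism with only \<open>L\<close> over
  \<open>ab\<close> is enough, by \<open>class_a_if_singleton_line_fibre\<close>.\<close>

lemma ex_class_a:
  assumes S: "finite_quadrangle S s t" and G: "is_quadrilateral G a b c d ab bc cd da"
  shows "\<exists>f g. epimorphism S G f g \<and> class_a s S G f g"
proof -
  interpret finite_quadrangle S s t
    by (rule S)
  have distG: "distinct [a, b, c, d] \<and> distinct [ab, bc, cd, da]"
    and ptsG: "pts G = {a, b, c, d}" and lnsG: "lns G = {ab, bc, cd, da}"
    and incG: "inc G = {(a, ab), (b, ab), (b, bc), (c, bc), (c, cd), (d, cd), (d, da), (a, da)}"
    using G unfolding is_quadrilateral_def by iprover+
  have ldist: "ab \<noteq> bc" "ab \<noteq> cd" "ab \<noteq> da"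
    using distG by auto
  have other_point: "\<exists>y. (y, M) \<in> inc S \<and> y \<noteq> x" if M: "M \<in> lns S" for x M
  proof (rule ccontr)
    assume "\<not> ?thesis"
    then have "points_on S M \<subseteq> {x}"
      by (auto simp: mem_points_on)
    then show False
      using card_mono[of "{x}" "points_on S M"] card_points_on[OF M] s_ge_2 by simp
  qed
  have other_line: "\<exists>N. (x, N) \<in> inc S \<and> N \<noteq> M" if x: "x \<in> pts S" for x M
  proof (rule ccontr)
    assume "\<not> ?thesis"
    then have "lines_through S x \<subseteq> {M}"
      by (auto simp: mem_lines_through)
    then show False
      using card_mono[of "{M}" "lines_through S x"] card_lines_through[OF x] t_ge_2 by simp
  qed
  \<comment> \<open>The path \<open>z\<close>, \<open>N\<close>, \<open>e\<close>, \<open>L\<close>,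
    \<open>p\<close>, \<open>M\<close>, \<open>w\<close>, \<open>K\<close> built here supplies a
    preimage of every point and line of \<open>G\<close>.\<close>
  obtain L where L: "L \<in> lns S"
    using geometry by (auto simp: point_line_geometry_def)
  obtain p where p: "(p, L) \<in> inc S"
    using other_point L by blast
  obtain e where e: "(e, L) \<in> inc S" "e \<noteq> p"
    using other_point L by blast
  obtain M where M: "(p, M) \<in> inc S" "M \<noteq> L"
    using other_line incD(1)[OF p] by blast
  obtain N where N: "(e, N) \<in> inc S" "N \<noteq> L"
    using other_line incD(1)[OF e(1)] by blast
  obtain w where w: "(w, M) \<in> inc S" "w \<noteq> p"
    using other_point incD(2)[OF M(1)] by blast
  obtain z where z: "(z, N) \<in> inc S" "z \<noteq> e"
    using other_point incD(2)[OF N(1)] by blast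
  have wL: "(w, L) \<notin> inc S" and zL: "(z, L) \<notin> inc S"
    using join_unique[OF M(1) w(1) p] join_unique[OF N(1) z(1) e(1)] M w N z by auto
  obtain K where K: "(w, K) \<in> inc S" "K \<noteq> M"
    using other_line incD(1)[OF w(1)] by blast
  define f where "f x = (if x = p then a else if (x, L) \<in> inc S then b
      else if collinear S x p then d else c)" for x
  define g where "g J = (if J = L then ab else if (p, J) \<in> inc S then da
      else if \<exists>x. (x, J) \<in> inc S \<and> (x, L) \<in> inc S then bc else cd)" for J
  have p_N: "(p, N) \<notin> inc S"
    using join_unique[OF e(1) p N(1)] e N by blast
  have K_L: "\<not> ((x, K) \<in> inc S \<and> (x, L) \<in> inc S)" for x
    using proj_unique[OF wL w(1) M(1) p K(1)] K by blast
  have z_p: "\<not> collinear S z p"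
    using proj_unique[OF zL z(1) N(1) e(1) _ _ p] e unfolding collinear_def by blast
  have w_p: "collinear S w p"
    using w M incD(2) unfolding collinear_def by blast
  have fv: "f p = a" "f e = b" "f z = c" "f w = d"
    using e p zL z_p wL w_p by (auto simp: f_def)
  have gv: "g L = ab" "g M = da" "g N = bc" "g K = cd"
    using M N e p_N K_L p L by (auto simp: g_def)
  have inc: "(f x, g J) \<in> inc G" if xJ: "(x, J) \<in> inc S" for x J
  proof -
    consider "J = L" | "J \<noteq> L" "(p, J) \<in> inc S"
      | y where "J \<noteq> L" "(p, J) \<notin> inc S" "(y, J) \<in> inc S" "(y, L) \<in> inc S"
      | "J \<noteq> L" "\<And>y. (y, J) \<in> inc S \<Longrightarrow> (y, L) \<notin> inc S"
      by blast
    then show ?thesis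
    proof cases
      case 1
      then show ?thesis
        using xJ by (auto simp: f_def g_def incG)
    next
      case 2
      have "(x, L) \<notin> inc S" if "x \<noteq> p"
        using join_unique[OF xJ 2(2) _ p] that 2 by blast
      moreover have "collinear S x p"
        using xJ 2 incD(2) unfolding collinear_def by blast
      ultimately show ?thesis
        using 2 by (auto simp: f_def g_def incG)
    next
      case 3
      have "x \<noteq> p"
        using 3 xJ by blast
      moreover have "\<not> collinear S x p" if xL: "(x, L) \<notin> inc S"
        using proj_unique[OF xL xJ 3(3,4) _ _ p] 3(2,3) unfolding collinear_def by blast
      moreover have "g J = bc"
        using 3 by (auto simp: g_def)
      ultimately show ?thesis
        by (auto simp: f_def incG)
    next
      case 4
      then have "(x, L) \<notin> inc S" "g J = cd"
        using xJ p by (auto simp: g_def)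
      then show ?thesis
        using p by (auto simp: f_def incG)
    qed
  qed
  have "f ` pts S \<subseteq> pts G" "g ` lns S \<subseteq> lns G"
    by (auto simp: f_def g_def ptsG lnsG)
  moreover have "pts G \<subseteq> f ` pts S"
    using fv[symmetric] incD(1)[OF p] incD(1)[OF e(1)] incD(1)[OF z(1)] incD(1)[OF w(1)]
    unfolding ptsG by blast
  moreover have "lns G \<subseteq> g ` lns S"
    using gv[symmetric] L incD(2)[OF M(1)] incD(2)[OF N(1)] incD(2)[OF K(1)]
    unfolding lnsG by blast
  ultimately have epi: "epimorphism S G f g"
    using inc unfolding epimorphism_def morphism_def by blast
  have "line_fibre S g ab = {L}"
    using L ldist by (auto simp: line_fibre_def g_def split: if_splits)
  then show ?thesis
    using class_a_if_singleton_line_fibre[OF S G epi] epi by blast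
qed

lemma ex_class_b:
  assumes S: "finite_quadrangle S s t" and G: "is_quadrilateral G a b c d ab bc cd da"
  shows "\<exists>f g. epimorphism S G f g \<and> class_b t S G f g"
proof -
  obtain g f where "epimorphism (dual S) (dual G) g f" "class_a t (dual S) (dual G) g f"
    using ex_class_a[OF finite_quadrangle.finite_quadrangle_dual[OF S] is_quadrilateral_dual[OF G]] by blast
  then show ?thesis
    using epimorphism_dual unfolding class_b_def by blast
qed

section \<open>Examples\<close>

text \<open>Points and lines share one numbering. When the incidence is symmetric, as
  \<open>polar_quadrangle\<close> demands, equal numbers form a polarity, so \<open>A ! i\<close>
  lists both the points on line \<open>i\<close> and the lines through point
  \<open>i\<close>.\<close>

definition polar_geometry :: "nat list list \<Rightarrow> (nat, nat) geometry" where
  "polar_geometry A = \<lparr>pts = {..<length A}, lns = {..<length A},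
     inc = {(x, M). M < length A \<and> x \<in> set (A ! M)}\<rparr>"

text \<open>The antiflag condition counts the chains \<open>x I N I y I M\<close>.\<close>

definition polar_quadrangle :: "nat \<Rightarrow> nat list list \<Rightarrow> bool" where
  "polar_quadrangle k A \<longleftrightarrow>
    list_all (\<lambda>M. distinct (A ! M) \<and> length (A ! M) = k \<and>
      list_all (\<lambda>x. x < length A \<and> M \<in> set (A ! x)) (A ! M)) [0..<length A] \<and>
    list_all (\<lambda>M. list_all (\<lambda>N. N = M \<or>
      length (filter (\<lambda>x. x \<in> set (A ! M)) (A ! N)) \<le> 1) [0..<length A]) [0..<length A] \<and>
    list_all (\<lambda>M. list_all (\<lambda>x. x \<in> set (A ! M) \<or>
      length (concat (map (\<lambda>N. map (Pair N) (filter (\<lambda>y. y \<in> set (A ! M)) (A ! N))) (A ! x))) = 1)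
      [0..<length A]) [0..<length A]"

text \<open>This reduces the examples to a check by evaluation: exactly one chain for each antiflag
  is existence and uniqueness of projections, and symmetry gives the statements on pencils.\<close>

lemma polar_quadrangle:
  assumes A: "polar_quadrangle k A" and k: "2 \<le> k" and ne: "A \<noteq> []"
  shows "weak_generalized_polygon 4 (polar_geometry A)"
    and "has_order (polar_geometry A) (k - 1) (k - 1)"
proof -
  let ?S = "polar_geometry A"
  have upt: "list_all P [0..<n] \<longleftrightarrow> (\<forall>i<n. P i)" for P n
    by (auto simp: list_all_iff)
  have entries: "\<forall>M<length A. distinct (A ! M) \<and> length (A ! M) = k \<and>
      (\<forall>x\<in>set (A ! M). x < length A \<and> M \<in> set (A ! x))"
    and common: "\<forall>M<length A. \<forall>N<length A. N = M \<or>
      length (filter (\<lambda>x. x \<in> set (A ! M)) (A ! N)) \<le> 1"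
    and chains: "\<forall>M<length A. \<forall>x<length A. x \<in> set (A ! M) \<or>
      length (concat (map (\<lambda>N. map (Pair N) (filter (\<lambda>y. y \<in> set (A ! M)) (A ! N))) (A ! x))) = 1"
    using A unfolding polar_quadrangle_def upt unfolding list_all_iff by iprover+
  have list: "distinct (A ! M)" "length (A ! M) = k" if "M < length A" for M
    using entries that by blast+
  have sym: "x < length A" "M \<in> set (A ! x)" if "M < length A" "x \<in> set (A ! M)" for M x
    using entries that by blast+
  have pts: "pts ?S = {..<length A}" and lns: "lns ?S = {..<length A}"
    by (simp_all add: polar_geometry_def)
  have inc: "(x, M) \<in> inc ?S \<longleftrightarrow> M < length A \<and> x \<in> set (A ! M)" for x M
    by (simp add: polar_geometry_def)
  have inc': "(x, M) \<in> inc ?S \<longleftrightarrow> x < length A \<and> M \<in> set (A ! x)" for x M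
    unfolding inc using sym by blast
  have on: "points_on ?S M = set (A ! M)" "lines_through ?S M = set (A ! M)" if "M < length A" for M
  proof -
    show "points_on ?S M = set (A ! M)"
      unfolding points_on_def pts inc using that sym by blast
    show "lines_through ?S M = set (A ! M)"
      unfolding lines_through_def lns inc' using that sym by blast
  qed
  have card: "card (set (A ! M)) = k" if "M < length A" for M
    using list[OF that] distinct_card by metis
  show "has_order ?S (k - 1) (k - 1)"
    using card on k by (simp add: has_order_def pts lns)
  have proj1: "\<exists>N y. {(N', y'). (x, N') \<in> inc ?S \<and> (y', N') \<in> inc ?S \<and> (y', M) \<in> inc ?S} = {(N, y)}"
    if x: "x < length A" and M: "M < length A" and xM: "(x, M) \<notin> inc ?S" for x M
  proof -
    let ?l = "concat (map (\<lambda>N. map (Pair N) (filter (\<lambda>y. y \<in> set (A ! M)) (A ! N))) (A ! x))"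
    have "length ?l = 1"
      using chains x M xM unfolding inc by blast
    then obtain p where "?l = [p]"
      by (auto simp: length_Suc_conv)
    then have "set ?l = {p}"
      by simp
    moreover have "set ?l = {(N', y'). (x, N') \<in> inc ?S \<and> (y', N') \<in> inc ?S \<and> (y', M) \<in> inc ?S}"
    proof (rule set_eqI)
      fix p :: "nat \<times> nat"
      obtain N y where "p = (N, y)"
        by fastforce
      moreover have "(x, N) \<in> inc ?S \<longleftrightarrow> N \<in> set (A ! x)" "(y, M) \<in> inc ?S \<longleftrightarrow> y \<in> set (A ! M)"
        "N \<in> set (A ! x) \<Longrightarrow> (y, N) \<in> inc ?S \<longleftrightarrow> y \<in> set (A ! N)"
        using x M sym(1)[OF x] inc'[of x N] inc[of y M] inc[of y N] by auto
      ultimately show "p \<in> set ?l \<longleftrightarrow>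
          p \<in> {(N', y'). (x, N') \<in> inc ?S \<and> (y', N') \<in> inc ?S \<and> (y', M) \<in> inc ?S}"
        by auto
    qed
    ultimately show ?thesis
      by (metis prod.collapse)
  qed
  interpret quadrangle ?S
  proof
    have "A ! 0 \<noteq> []"
      using list(2)[of 0] ne k by auto
    then show "point_line_geometry ?S"
      using ne sym(1) by (auto simp: point_line_geometry_def polar_geometry_def)
    show "x = y \<or> M = N"
      if "(x, M) \<in> inc ?S" "(y, M) \<in> inc ?S" "(x, N) \<in> inc ?S" "(y, N) \<in> inc ?S" for x M y N
    proof (rule disjCI)
      assume "M \<noteq> N"
      let ?l = "filter (\<lambda>x. x \<in> set (A ! M)) (A ! N)"
      have "length ?l \<le> 1"
        using common that \<open>M \<noteq> N\<close> unfolding inc by blast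
      moreover have "{x, y} \<subseteq> set ?l"
        using that by (simp add: inc)
      ultimately have "card {x, y} \<le> 1"
        using card_mono[of "set ?l" "{x, y}"] card_length[of ?l] by simp
      then show "x = y"
        by (cases "x = y") simp_all
    qed
    show "\<exists>N y. (x, N) \<in> inc ?S \<and> (y, N) \<in> inc ?S \<and> (y, M) \<in> inc ?S"
      if "x \<in> pts ?S" "M \<in> lns ?S" "(x, M) \<notin> inc ?S" for x M
      using proj1[of x M] that unfolding pts lns by blast
    show "y = y' \<and> N = N'"
      if "(x, M) \<notin> inc ?S" "(x, N) \<in> inc ?S" "(y, N) \<in> inc ?S" "(y, M) \<in> inc ?S"
        "(x, N') \<in> inc ?S" "(y', N') \<in> inc ?S" "(y', M) \<in> inc ?S" for x M N y N' y'
    proof -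
      have "x < length A" "M < length A"
        using that(2,4) inc'[of x N] inc[of y M] by blast+
      from proj1[OF this that(1)] obtain N0 y0 where eq:
        "{(N', y'). (x, N') \<in> inc ?S \<and> (y', N') \<in> inc ?S \<and> (y', M) \<in> inc ?S} = {(N0, y0)}"
        by iprover
      have "(N, y) \<in> {(N0, y0)}" "(N', y') \<in> {(N0, y0)}"
        unfolding eq[symmetric] using that by simp_all
      then show ?thesis
        by simp
    qed
  qed
  have other: "\<exists>y. y \<noteq> x \<and> y \<in> set (A ! M)" if "M < length A" for x M
  proof (rule ccontr)
    assume "\<not> ?thesis"
    then have "set (A ! M) \<subseteq> {x}"
      by blast
    then show False
      using card_mono[of "{x}" "set (A ! M)"] card[OF that] k by simp
  qed
  show "weak_generalized_polygon 4 ?S"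
  proof (rule weak_generalized_polygonI)
    show "\<exists>y. y \<noteq> x \<and> (y, M) \<in> inc ?S" if "(x, M) \<in> inc ?S" for x M
      using that other unfolding inc by blast
    show "\<exists>N. N \<noteq> M \<and> (x, N) \<in> inc ?S" if "(x, M) \<in> inc ?S" for x M
      using that other unfolding inc' by blast
    show "\<exists>M. (x, M) \<in> inc ?S" if "x \<in> pts ?S" for x
      using that other unfolding inc' pts by blast
    show "\<exists>x. (x, M) \<in> inc ?S" if "M \<in> lns ?S" for M
      using that other unfolding inc lns by blast
  qed
qed

text \<open>The line numbered \<open>M\<close> of the ordinary quadrangle joins the points \<open>- M\<close> and \<open>1 - M\<close>
  modulo 4.\<close>

lemma grid_square: "grid (polar_geometry [[0, 1], [0, 3], [2, 3], [1, 2]]) 1"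
proof -
  let ?A = "[[0, 1], [0, 3], [2, 3], [1, 2]] :: nat list list"
  have A: "polar_quadrangle 2 ?A"
    unfolding polar_quadrangle_def by code_simp
  have "\<not> thick (polar_geometry ?A)"
  proof
    assume "thick (polar_geometry ?A)"
    moreover have "0 \<in> lns (polar_geometry ?A)"
      by (simp add: polar_geometry_def)
    ultimately obtain X where "X \<subseteq> points_on (polar_geometry ?A) 0" "card X = 3"
      unfolding thick_def by meson
    moreover have "points_on (polar_geometry ?A) 0 \<subseteq> {0, 1}"
      by (auto simp: polar_geometry_def points_on_def)
    ultimately have "X \<subseteq> {0, 1}" "card X = 3"
      by auto
    then show False
      using card_mono[of "{0, 1::nat}" X] by simp
  qed
  then show ?thesis
    using polar_quadrangle[OF A] by (simp add: grid_def)
qed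

text \<open>The generalized quadrangle \<open>W(2)\<close>: its points are the pairs from a six-element set, its lines
  the partitions of that set into three pairs. Points and lines are numbered along a polarity.\<close>

definition doily_lines :: "nat list list" where
  "doily_lines = [[0, 9, 14], [1, 7, 13], [2, 8, 10], [3, 6, 11], [4, 5, 12], [4, 6, 10],
    [3, 5, 13], [1, 8, 12], [2, 7, 11], [0, 11, 12], [2, 5, 14], [3, 8, 9], [4, 7, 9],
    [1, 6, 14], [0, 10, 13]]"

lemma finite_thick_quadrangle_doily: "finite_thick_quadrangle (polar_geometry doily_lines) 2 2"
proof -
  let ?S = "polar_geometry doily_lines"
  have A: "polar_quadrangle 3 doily_lines"
    by code_simp
  have ne: "doily_lines \<noteq> []"
    by (simp add: doily_lines_def)
  have order: "has_order ?S 2 2" and weak: "weak_generalized_polygon 4 ?S"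
    using polar_quadrangle[OF A _ ne] by simp_all
  \<comment> \<open>Point rows and pencils have exactly three elements, so each is its own
    witness.\<close>
  have "thick ?S"
    using order unfolding thick_def has_order_def by fastforce
  then show ?thesis
    using order weak by (simp add: finite_thick_quadrangle_def polar_geometry_def)
qed

text \<open>That both classes occur is rendered twice: \<open>S\<close> admits maps of both classes
  onto \<open>G\<close> whenever \<open>s' = 1\<close>, and explicit instances, from
  \<open>W(2)\<close> onto the ordinary quadrangle, show that this is not vacuous.\<close>

theorem theorem4p1:
  fixes S :: "('p, 'l) geometry" and G :: "('q, 'm) geometry" and s t s' :: nat
  assumes "finite_thick_quadrangle S s t" and "grid G s'"
  shows "(\<forall>f g. epimorphism S G f g \<longrightarrow> s' = 1 \<and> (class_a s S G f g \<or> class_b t S G f g)) \<and>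
    (s' = 1 \<longrightarrow>
       (\<exists>f g. epimorphism S G f g \<and> class_a s S G f g) \<and>
       (\<exists>f g. epimorphism S G f g \<and> class_b t S G f g)) \<and>
    (\<exists>(S\<^sub>0 :: (nat, nat) geometry) (G\<^sub>0 :: (nat, nat) geometry) s\<^sub>0 t\<^sub>0 f g.
       finite_thick_quadrangle S\<^sub>0 s\<^sub>0 t\<^sub>0 \<and> grid G\<^sub>0 1 \<and>
       epimorphism S\<^sub>0 G\<^sub>0 f g \<and> class_a s\<^sub>0 S\<^sub>0 G\<^sub>0 f g) \<and>
    (\<exists>(S\<^sub>0 :: (nat, nat) geometry) (G\<^sub>0 :: (nat, nat) geometry) s\<^sub>0 t\<^sub>0 f g.
       finite_thick_quadrangle S\<^sub>0 s\<^sub>0 t\<^sub>0 \<and> grid G\<^sub>0 1 \<and>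
       epimorphism S\<^sub>0 G\<^sub>0 f g \<and> class_b t\<^sub>0 S\<^sub>0 G\<^sub>0 f g)"
proof (intro conjI allI impI)
  note S = finite_quadrangle_if_thick[OF assms(1)]
  note thin = dual_thin_quadrangle_if_grid[OF assms(2)]
  show s': "s' = 1" if "epimorphism S G f g" for f g
    using dual_thin_quadrangle.no_epimorphism_if_three_points[OF thin S that]
      grid_third_point[OF assms(2)] by metis
  show "class_a s S G f g \<or> class_b t S G f g" if epi: "epimorphism S G f g" for f g
    using is_quadrilateral_if_grid class_a_or_b[OF S thin _ epi] assms(2) s'[OF epi] by metis
  show "\<exists>f g. epimorphism S G f g \<and> class_a s S G f g" if "s' = 1"
    using is_quadrilateral_if_grid ex_class_a[OF S] assms(2) that by metis
  show "\<exists>f g. epimorphism S G f g \<and> class_b t S G f g" if "s' = 1"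
    using is_quadrilateral_if_grid ex_class_b[OF S] assms(2) that by metis
next
  note S = finite_quadrangle_if_thick[OF finite_thick_quadrangle_doily]
  show "\<exists>(S\<^sub>0 :: (nat, nat) geometry) (G\<^sub>0 :: (nat, nat) geometry) s\<^sub>0 t\<^sub>0 f g.
      finite_thick_quadrangle S\<^sub>0 s\<^sub>0 t\<^sub>0 \<and> grid G\<^sub>0 1 \<and>
      epimorphism S\<^sub>0 G\<^sub>0 f g \<and> class_a s\<^sub>0 S\<^sub>0 G\<^sub>0 f g"
    using is_quadrilateral_if_grid[OF grid_square] ex_class_a[OF S] finite_thick_quadrangle_doily grid_square
    by metis
  show "\<exists>(S\<^sub>0 :: (nat, nat) geometry) (G\<^sub>0 :: (nat, nat) geometry) s\<^sub>0 t\<^sub>0 f g.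
      finite_thick_quadrangle S\<^sub>0 s\<^sub>0 t\<^sub>0 \<and> grid G\<^sub>0 1 \<and>
      epimorphism S\<^sub>0 G\<^sub>0 f g \<and> class_b t\<^sub>0 S\<^sub>0 G\<^sub>0 f g"
    using is_quadrilateral_if_grid[OF grid_square] ex_class_b[OF S] finite_thick_quadrangle_doily grid_square
    by metis
qed

end
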